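(* There is a tight PLS-reduction from weighted $\textsc{Max-2-SAT}$ with the flip neighborhood to $\textsc{MaxAssets}_v$ with the swap neighborhood.
   Context: Weighted $\textsc{Max-2-SAT}$: given a CNF formula whose clauses have at most two literals and positive integer weights, find a truth assignment maximizing the total weight of satisfied clauses; the flip neighborhood of an assignment consists of all assignments differing in exactly one variable. $\textsc{MaxAssets}_v$: an instance consists of a set $V$ of banks, external assets $a^x_w\in\mathbb{N}$ for each bank, for each bank a collection of incoming and outgoing stubs (half-edges) each with a positive weight, such that the stubs are consistent with at least one edge set (i.e., they can be matched, each incoming stub of weight $l$ at $w$ with an outgoing stub of weight $l$ at some bank $u\ne w$, to form a loop-free graph $G=(V,E)$ with liabilities $l_{(u,w)}=l$), an edge-ranking allocation rule (each bank pays its outgoing stubs in a fixed order, each fully before the next) given implicitly by a polynomial-time clearing oracle that returns the clearing state of any network, and a distinguished bank $v$. Feasible solutions are financial networks whose edge sets are consistent with the stubs; the objective (to maximize) is the total assets $a_v$ of $v$ in the clearing state, i.e., in the pointwise maximal vector $(a_w)$ satisfying $a_w=a^x_w+\sum_{e=(u,w)}f_e(a_u)$. The swap neighborhood of a network consists of all networks obtainable by one debt swap: for edges $(u_1,v_1),(u_2,v_2)$ with equal weights and pairwise distinct endpoints, replace them by $(u_1,v_2)$ and $(u_2,v_1)$ with that weight (each debtor keeps its stub and its payment order). A tight PLS-reduction is in the sense of Schäffer and Yannakakis. *)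

theory Defs imports Complex_Main begin

section \<open>Polynomial-time computability\<close>

text \<open>
  The machine model is Jones's WHILE language over binary trees (Jones, Computability and
  Complexity from a Programming Perspective).  An expression is charged the sizes of all
  intermediate values (and not unit cost as in Jones's book), so that repeated doubling of a tree
  is not free and running times are polynomially related to those of Turing machines, also for
  functions whose output is large.
\<close>

datatype tree = Leaf | Node tree tree

fun tsize :: "tree \<Rightarrow> nat" where
  "tsize Leaf = 1"
| "tsize (Node l r) = Suc (tsize l + tsize r)"

fun left :: "tree \<Rightarrow> tree" where
  "left Leaf = Leaf"
| "left (Node l r) = l"

fun right :: "tree \<Rightarrow> tree" where
  "right Leaf = Leaf"
| "right (Node l r) = r"

fun enc_bool :: "bool \<Rightarrow> tree" where
  "enc_bool False = Leaf"
| "enc_bool True = Node Leaf Leaf"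

datatype expr =
    Var nat
  | ELeaf
  | ENode expr expr
  | ELeft expr
  | ERight expr
  | EEq expr expr

datatype com =
    Assign nat expr
  | Seq com com
  | If expr com com
  | While expr com

type_synonym state = "nat \<Rightarrow> tree"

fun eval :: "expr \<Rightarrow> state \<Rightarrow> tree" where
  "eval (Var x) s = s x"
| "eval ELeaf s = Leaf"
| "eval (ENode a b) s = Node (eval a s) (eval b s)"
| "eval (ELeft a) s = left (eval a s)"
| "eval (ERight a) s = right (eval a s)"
| "eval (EEq a b) s = enc_bool (eval a s = eval b s)"

fun cost :: "expr \<Rightarrow> state \<Rightarrow> nat" where
  "cost (Var x) s = tsize (s x)"
| "cost ELeaf s = 1"
| "cost (ENode a b) s = cost a s + cost b s + tsize (eval (ENode a b) s)"
| "cost (ELeft a) s = cost a s + tsize (eval (ELeft a) s)"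
| "cost (ERight a) s = cost a s + tsize (eval (ERight a) s)"
| "cost (EEq a b) s = cost a s + cost b s + tsize (eval (EEq a b) s)"

text \<open>\<open>exec c s t s'\<close>: started in \<open>s\<close>, program \<open>c\<close> halts in \<open>s'\<close> after time \<open>t\<close>.
  A test succeeds iff its value is not \<^const>\<open>Leaf\<close>.\<close>

inductive exec :: "com \<Rightarrow> state \<Rightarrow> nat \<Rightarrow> state \<Rightarrow> bool" where
  Assign: "exec (Assign x e) s (cost e s) (s(x := eval e s))"
| Seq: "exec c1 s t1 s1 \<Longrightarrow> exec c2 s1 t2 s2 \<Longrightarrow> exec (Seq c1 c2) s (t1 + t2) s2"
| IfTrue: "eval e s \<noteq> Leaf \<Longrightarrow> exec c1 s t s' \<Longrightarrow> exec (If e c1 c2) s (cost e s + t) s'"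
| IfFalse: "eval e s = Leaf \<Longrightarrow> exec c2 s t s' \<Longrightarrow> exec (If e c1 c2) s (cost e s + t) s'"
| WhileFalse: "eval e s = Leaf \<Longrightarrow> exec (While e c) s (cost e s) s"
| WhileTrue: "eval e s \<noteq> Leaf \<Longrightarrow> exec c s t1 s1 \<Longrightarrow> exec (While e c) s1 t2 s2
    \<Longrightarrow> exec (While e c) s (cost e s + t1 + t2) s2"

text \<open>Input and output are in variable \<open>0\<close>.  As sizes are positive, the bounds \<open>a * n ^ k\<close>
  dominate all polynomials.\<close>

definition polytime_on ::
  "'a set \<Rightarrow> ('a \<Rightarrow> tree) \<Rightarrow> ('b \<Rightarrow> tree) \<Rightarrow> ('a \<Rightarrow> 'b) \<Rightarrow> bool" where
  "polytime_on D enc_in enc_out f \<longleftrightarrow>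
     (\<exists>c a k. \<forall>x\<in>D. \<exists>t s'.
        exec c ((\<lambda>_. Leaf)(0 := enc_in x)) t s' \<and>
        s' 0 = enc_out (f x) \<and>
        t \<le> a * tsize (enc_in x) ^ k)"

fun enc_list :: "('a \<Rightarrow> tree) \<Rightarrow> 'a list \<Rightarrow> tree" where
  "enc_list enc [] = Leaf"
| "enc_list enc (x # xs) = Node (enc x) (enc_list enc xs)"

fun enc_pair :: "('a \<Rightarrow> tree) \<Rightarrow> ('b \<Rightarrow> tree) \<Rightarrow> 'a \<times> 'b \<Rightarrow> tree" where
  "enc_pair enc1 enc2 (x, y) = Node (enc1 x) (enc2 y)"

text \<open>Binary representation, least significant bit first.\<close>

fun enc_nat :: "nat \<Rightarrow> tree" where
  "enc_nat n = (if n = 0 then Leaf else Node (enc_bool (odd n)) (enc_nat (n div 2)))"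

declare enc_nat.simps [simp del]


section \<open>Local search problems and tight PLS-reductions\<close>

text \<open>All problems are maximization problems.\<close>

record ('i, 's) local_search =
  instances :: "'i set"
  feasible :: "'i \<Rightarrow> 's set"
  objective :: "'i \<Rightarrow> 's \<Rightarrow> real"
  neighborhood :: "'i \<Rightarrow> 's \<Rightarrow> 's set"
  enc_instance :: "'i \<Rightarrow> tree"
  enc_solution :: "'s \<Rightarrow> tree"

definition transition_graph :: "('i, 's) local_search \<Rightarrow> 'i \<Rightarrow> ('s \<times> 's) set" where
  "transition_graph P x =
     {(s, s'). s \<in> feasible P x \<and> s' \<in> feasible P x \<and> s' \<in> neighborhood P x s \<and>
               objective P x s < objective P x s'}"

definition local_optima :: "('i, 's) local_search \<Rightarrow> 'i \<Rightarrow> 's set" where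
  "local_optima P x =
     {s \<in> feasible P x.
        \<forall>s' \<in> neighborhood P x s \<inter> feasible P x. objective P x s' \<le> objective P x s}"

definition PLS_reduction ::
  "('i, 's) local_search \<Rightarrow> ('j, 'r) local_search \<Rightarrow> ('i \<Rightarrow> 'j) \<Rightarrow> ('i \<Rightarrow> 'r \<Rightarrow> 's) \<Rightarrow> bool" where
  "PLS_reduction P Q h g \<longleftrightarrow>
     (\<forall>x \<in> instances P. h x \<in> instances Q) \<and>
     polytime_on (instances P) (enc_instance P) (enc_instance Q) h \<and>
     (\<forall>x \<in> instances P. \<forall>q \<in> feasible Q (h x). g x q \<in> feasible P x) \<and>
     polytime_on (SIGMA x : instances P. feasible Q (h x))
       (enc_pair (enc_instance P) (enc_solution Q)) (enc_solution P) (\<lambda>(x, q). g x q) \<and>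
     (\<forall>x \<in> instances P. \<forall>q \<in> local_optima Q (h x). g x q \<in> local_optima P x)"

text \<open>\<open>R x\<close> is the set of reasonable solutions of \<open>h x\<close>.  In the last condition \<open>qs\<close> is the vertex
  sequence of a path with at least one arc, all of whose inner vertices lie outside \<open>R x\<close>.\<close>

definition tight_PLS_reduction ::
  "('i, 's) local_search \<Rightarrow> ('j, 'r) local_search \<Rightarrow> ('i \<Rightarrow> 'j) \<Rightarrow> ('i \<Rightarrow> 'r \<Rightarrow> 's) \<Rightarrow> bool" where
  "tight_PLS_reduction P Q h g \<longleftrightarrow>
     PLS_reduction P Q h g \<and>
     (\<exists>R.
        (\<forall>x \<in> instances P. R x \<subseteq> feasible Q (h x)) \<and>
        (\<forall>x \<in> instances P. local_optima Q (h x) \<subseteq> R x) \<and>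
        (\<exists>r. (\<forall>x \<in> instances P. \<forall>p \<in> feasible P x. r x p \<in> R x \<and> g x (r x p) = p) \<and>
             polytime_on (SIGMA x : instances P. feasible P x)
               (enc_pair (enc_instance P) (enc_solution P)) (enc_solution Q) (\<lambda>(x, p). r x p)) \<and>
        (\<forall>x \<in> instances P. \<forall>qs.
           2 \<le> length qs \<and>
           (\<forall>i. Suc i < length qs \<longrightarrow> (qs ! i, qs ! Suc i) \<in> transition_graph Q (h x)) \<and>
           hd qs \<in> R x \<and> last qs \<in> R x \<and>
           (\<forall>i. 0 < i \<and> Suc i < length qs \<longrightarrow> qs ! i \<notin> R x) \<longrightarrow>
           g x (hd qs) = g x (last qs) \<or>
           (g x (hd qs), g x (last qs)) \<in> transition_graph P x))"


section \<open>Weighted Max-2-SAT with the flip neighborhood\<close>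

text \<open>\<open>(x, b)\<close> is the positive literal of variable \<open>x\<close> if \<open>b\<close>, and the negative one otherwise.\<close>

type_synonym literal = "nat \<times> bool"
type_synonym wclause = "literal list \<times> nat"

record cnf =
  num_vars :: nat
  clauses :: "wclause list"

definition satisfies :: "bool list \<Rightarrow> literal list \<Rightarrow> bool" where
  "satisfies \<alpha> C \<longleftrightarrow> (\<exists>(x, b) \<in> set C. \<alpha> ! x = b)"

text \<open>The number of variables is encoded in unary, as if the variables were listed; in binary,
  an assignment could be exponentially larger than its instance.\<close>

definition max_2_sat :: "(cnf, bool list) local_search" where
  "max_2_sat = \<lparr>
     instances = {\<phi>. \<forall>(C, w) \<in> set (clauses \<phi>).
       length C \<le> 2 \<and> (\<forall>(x, b) \<in> set C. x < num_vars \<phi>) \<and> 0 < w},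
     feasible = (\<lambda>\<phi>. {\<alpha>. length \<alpha> = num_vars \<phi>}),
     objective = (\<lambda>\<phi> \<alpha>. real (\<Sum>(C, w) \<leftarrow> clauses \<phi>. if satisfies \<alpha> C then w else 0)),
     neighborhood = (\<lambda>\<phi> \<alpha>. {\<alpha>[x := \<not> \<alpha> ! x] | x. x < num_vars \<phi>}),
     enc_instance = (\<lambda>\<phi>. enc_pair
       (enc_list (\<lambda>_. Leaf))
       (enc_list (enc_pair (enc_list (enc_pair enc_nat enc_bool)) enc_nat))
       ([0..<num_vars \<phi>], clauses \<phi>)),
     enc_solution = enc_list enc_bool \<rparr>"


section \<open>MaxAssets with the swap neighborhood\<close>

text \<open>Banks are the positions of the list \<open>banks\<close>.  The weights of the outgoing stubs of a bank are
  listed in the order in which the bank pays them, so this list is also its edge ranking.\<close>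

record bank =
  external :: nat
  outgoing :: "nat list"
  incoming :: "nat list"

record stub_system =
  banks :: "bank list"
  target :: nat

definition out_stubs :: "stub_system \<Rightarrow> (nat \<times> nat) set" where
  "out_stubs S = (SIGMA u : {..<length (banks S)}. {..<length (outgoing (banks S ! u))})"

definition in_stubs :: "stub_system \<Rightarrow> (nat \<times> nat) set" where
  "in_stubs S = (SIGMA w : {..<length (banks S)}. {..<length (incoming (banks S ! w))})"

definition liability :: "stub_system \<Rightarrow> nat \<times> nat \<Rightarrow> nat" where
  "liability S = (\<lambda>(u, i). outgoing (banks S ! u) ! i)"

text \<open>A network records, for each bank and each of its outgoing stubs, the creditor at the other
  end.  Edges are identified with their outgoing stubs, so parallel edges are possible; incoming
  stubs of the same weight at the same bank are not told apart.\<close>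

type_synonym network = "nat list list"

definition creditor :: "network \<Rightarrow> nat \<times> nat \<Rightarrow> nat" where
  "creditor N = (\<lambda>(u, i). N ! u ! i)"

definition consistent :: "stub_system \<Rightarrow> network \<Rightarrow> bool" where
  "consistent S N \<longleftrightarrow>
     map length N = map (length \<circ> outgoing) (banks S) \<and>
     (\<exists>m. bij_betw m (out_stubs S) (in_stubs S) \<and>
        (\<forall>e \<in> out_stubs S.
           (case m e of (w, j) \<Rightarrow>
              creditor N e = w \<and> incoming (banks S ! w) ! j = liability S e \<and> fst e \<noteq> w)))"

definition payment :: "stub_system \<Rightarrow> nat \<times> nat \<Rightarrow> real \<Rightarrow> real" where
  "payment S = (\<lambda>(u, i) a.
     min (real (liability S (u, i))) (max 0 (a - (\<Sum>j<i. real (liability S (u, j))))))"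

definition clearing_solution :: "stub_system \<Rightarrow> network \<Rightarrow> real list \<Rightarrow> bool" where
  "clearing_solution S N a \<longleftrightarrow>
     length a = length (banks S) \<and>
     (\<forall>w < length (banks S).
        a ! w = real (external (banks S ! w)) +
          (\<Sum>e \<in> {e \<in> out_stubs S. creditor N e = w}. payment S e (a ! fst e)))"

text \<open>The pointwise maximal solution.  It is unique, and it exists by Knaster-Tarski since payments
  are monotone and bounded.  It is determined by the ranking and the network, so an oracle that
  returns clearing states adds no information to an instance.\<close>

definition clearing_state :: "stub_system \<Rightarrow> network \<Rightarrow> real list" where
  "clearing_state S N =
     (THE a. clearing_solution S N a \<and> (\<forall>b. clearing_solution S N b \<longrightarrow> list_all2 (\<le>) b a))"

definition swaps :: "stub_system \<Rightarrow> network \<Rightarrow> network set" where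
  "swaps S N =
     {N[u1 := (N ! u1)[i1 := v2], u2 := (N ! u2)[i2 := v1]] | u1 i1 v1 u2 i2 v2.
        (u1, i1) \<in> out_stubs S \<and> (u2, i2) \<in> out_stubs S \<and>
        v1 = creditor N (u1, i1) \<and> v2 = creditor N (u2, i2) \<and>
        liability S (u1, i1) = liability S (u2, i2) \<and>
        distinct [u1, v1, u2, v2]}"

definition max_assets :: "(stub_system, network) local_search" where
  "max_assets = \<lparr>
     instances = {S. target S < length (banks S) \<and>
       (\<forall>B \<in> set (banks S). \<forall>l \<in> set (outgoing B) \<union> set (incoming B). 0 < l) \<and>
       (\<exists>N. consistent S N)},
     feasible = (\<lambda>S. {N. consistent S N}),
     objective = (\<lambda>S N. clearing_state S N ! target S),
     neighborhood = swaps,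
     enc_instance = (\<lambda>S. enc_pair
       (enc_list (\<lambda>B. enc_pair enc_nat (enc_pair (enc_list enc_nat) (enc_list enc_nat))
          (external B, outgoing B, incoming B)))
       enc_nat
       (banks S, target S)),
     enc_solution = enc_list (enc_list enc_nat) \<rparr>"

end

theory Submission imports Defs begin

text \<open>
  For each variable \<open>x\<close> of a formula there is a weight \<open>W x\<close> that occurs on exactly two outgoing stubs,
  one of a rich source bank and one of a bank without assets, and on exactly two incoming stubs, one
  of each literal of \<open>x\<close>.  All other stubs either have a weight of their own or, for the edges that
  lead from a clause to the target, admit only one creditor.  Hence the consistent networks are the
  assignments (the source pays the true literals), and the swaps are the flips.  The bank of a true
  literal fully pays its edges to the clauses in which it occurs, and the bank of a clause \<open>C\<close> passes
  on at most the weight \<open>w\<close> of \<open>C\<close>.  As the weights of the edges into \<open>C\<close> exceed \<open>w\<close>, the target receives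
  exactly the weight of the satisfied clauses.  All networks are reasonable solutions.

  The large weights are powers of two, so that in binary they are computed from list lengths.
\<close>

section \<open>Polynomial-time functions on trees\<close>

text \<open>A stub may be matched with any stub of its weight, so the weights alone must keep the
  wiring of the occurrences rigid. All clause weights lie below
  \<open>2 ^ weight_bits \<phi>\<close>; the exponents of \<open>occ_weight\<close> start there, and
  those of \<open>var_weight\<close> continue where they end. So the three kinds of weights are
  disjoint, and the large ones differ for different occurrences and variables. As a sum of
  consecutive powers of two stays below the next one, a variable weight also exceeds all occurrence
  weights together. Hence a bank has nothing, or covers all its stubs, or has at most one stub, and
  each payment is a minimum of liability and assets. Edges lead from banks 1 and 2 over literals and
  clauses to the target; on such an acyclic network the clearing equations have just one solution,
  which is therefore the maximal one. The objectives agree exactly, and a path cannot have an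
  unreasonable inner vertex, so tightness is a statement about single arcs. The cost model charges
  for the size of all values, and a loop can double a tree in every round; each loop therefore comes
  with a bound on its intermediate values.\<close>

definition poly_bounded :: "(nat \<Rightarrow> nat) \<Rightarrow> bool" where
  "poly_bounded p \<longleftrightarrow> mono p \<and> (\<exists>a k. \<forall>n. p n \<le> a * Suc n ^ k)"

lemma poly_bounded_mono: "poly_bounded p \<Longrightarrow> m \<le> n \<Longrightarrow> p m \<le> p n"
  by (auto simp: poly_bounded_def mono_def)

lemma poly_bounded_const: "poly_bounded (\<lambda>_. c)"
  unfolding poly_bounded_def
  by (intro conjI exI[where P = "\<lambda>a. \<exists>k. \<forall>n. c \<le> a * Suc n ^ k", of c] exI[of _ 0]) (auto simp: mono_def)

lemma poly_bounded_id: "poly_bounded (\<lambda>n. n)"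
  unfolding poly_bounded_def by (auto simp: mono_def intro!: exI[of _ 1])

lemma poly_bounded_add:
  assumes "poly_bounded p" "poly_bounded q"
  shows "poly_bounded (\<lambda>n. p n + q n)"
proof -
  obtain a k b l where *: "\<And>n. p n \<le> a * Suc n ^ k" "\<And>n. q n \<le> b * Suc n ^ l"
    using assms unfolding poly_bounded_def by blast
  have "p n + q n \<le> (a + b) * Suc n ^ (k + l)" for n
  proof -
    have "p n \<le> a * Suc n ^ (k + l)"
      using *(1)[of n] by (rule order_trans) (intro mult_left_mono power_increasing, auto)
    moreover have "q n \<le> b * Suc n ^ (k + l)"
      using *(2)[of n] by (rule order_trans) (intro mult_left_mono power_increasing, auto)
    ultimately show ?thesis by (simp add: add_mult_distrib)
  qed
  then show ?thesis
    using assms by (auto simp: poly_bounded_def mono_def intro: add_mono)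
qed

lemma poly_bounded_mult:
  assumes "poly_bounded p" "poly_bounded q"
  shows "poly_bounded (\<lambda>n. p n * q n)"
proof -
  obtain a k b l where *: "\<And>n. p n \<le> a * Suc n ^ k" "\<And>n. q n \<le> b * Suc n ^ l"
    using assms unfolding poly_bounded_def by blast
  have "p n * q n \<le> (a * b) * Suc n ^ (k + l)" for n
    using mult_mono[OF *(1)[of n] *(2)[of n]] by (simp add: power_add algebra_simps)
  moreover have "mono (\<lambda>n. p n * q n)"
    using assms by (auto simp: poly_bounded_def mono_def intro!: mult_le_mono)
  ultimately show ?thesis
    unfolding poly_bounded_def by blast
qed

lemma poly_bounded_comp:
  assumes "poly_bounded p" "poly_bounded q"
  shows "poly_bounded (\<lambda>n. p (q n))"
proof -
  obtain a k b l where *: "\<And>n. p n \<le> a * Suc n ^ k" "\<And>n. q n \<le> b * Suc n ^ l"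
    using assms unfolding poly_bounded_def by blast
  have "p (q n) \<le> (a * Suc b ^ k) * Suc n ^ (l * k)" for n
  proof -
    have "Suc (q n) \<le> Suc b * Suc n ^ l"
      using add_mono[OF one_le_power[of "Suc n" l] *(2)[of n]] by simp
    from mult_left_mono[OF power_mono[OF this, of k], of a]
    have "a * Suc (q n) ^ k \<le> a * (Suc b ^ k * Suc n ^ (l * k))"
      by (simp add: power_mult_distrib power_mult del: mult_Suc power_Suc)
    with *(1)[of "q n"] show ?thesis unfolding mult.assoc by (rule order_trans)
  qed
  moreover have "mono (\<lambda>n. p (q n))"
    by (intro monoI poly_bounded_mono[OF assms(1)] poly_bounded_mono[OF assms(2)])
  ultimately show ?thesis
    unfolding poly_bounded_def by blast
qed

lemmas poly_bounded_intros =
  poly_bounded_const poly_bounded_id poly_bounded_add poly_bounded_mult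

text \<open>The program for register \<open>d\<close> must leave the registers below \<open>d\<close> unchanged and must not rely on
  the contents of those above, so that such programs can be composed without renaming.\<close>

definition computes :: "com \<Rightarrow> nat \<Rightarrow> (nat \<Rightarrow> nat) \<Rightarrow> (tree \<Rightarrow> tree) \<Rightarrow> bool" where
  "computes c d p f \<longleftrightarrow> (\<forall>s. \<exists>t s'. exec c s t s' \<and> s' d = f (s d) \<and> (\<forall>i<d. s' i = s i) \<and>
     t \<le> p (tsize (s d)))"

text \<open>The bound \<open>p\<close> is chosen before the register \<open>d\<close>. It bounds the
  size of \<open>f x\<close> as well, because a program that is run afterwards is timed by the size
  of what it is given.\<close>

definition ptime :: "(tree \<Rightarrow> tree) \<Rightarrow> bool" where
  "ptime f \<longleftrightarrow> (\<exists>p. poly_bounded p \<and> (\<forall>x. tsize (f x) \<le> p (tsize x)) \<and>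
     (\<forall>d. \<exists>c. computes c d p f))"

lemma ptimeI:
  assumes "poly_bounded p" "\<And>x. tsize (f x) \<le> p (tsize x)" "\<And>d. \<exists>c. computes c d p f"
  shows "ptime f"
  using assms unfolding ptime_def by blast

lemma ptimeE:
  assumes "ptime f"
  obtains p where "poly_bounded p" "\<And>x. tsize (f x) \<le> p (tsize x)"
    "\<And>d. \<exists>c. computes c d p f"
  using assms unfolding ptime_def by blast

lemma computesE:
  assumes "computes c d p f"
  obtains t s' where "exec c s t s'" "s' d = f (s d)" "\<forall>i<d. s' i = s i" "t \<le> p (tsize (s d))"
  using assms unfolding computes_def by blast

section \<open>Basic operations, composition and case distinction\<close>

lemma exec_Assign: "t = cost e s \<Longrightarrow> s' = s(x := eval e s) \<Longrightarrow> exec (Assign x e) s t s'"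
  by (simp add: exec.Assign)

lemma tsize_pos: "0 < tsize t"
  by (cases t) auto

lemma tsize_left: "tsize (left t) \<le> tsize t"
  and tsize_right: "tsize (right t) \<le> tsize t"
  by (cases t; simp)+

lemma ptime_Assign:
  assumes "\<And>s d. eval (e d) s = f (s d)" "\<And>s d. cost (e d) s \<le> p (tsize (s d))"
    and "\<And>x. tsize (f x) \<le> p (tsize x)" "poly_bounded p"
  shows "ptime f"
proof (rule ptimeI[OF assms(4,3)])
  fix d
  have "computes (Assign d (e d)) d p f"
    unfolding computes_def
    by (intro allI exI conjI, rule exec.Assign) (simp_all add: assms)
  then show "\<exists>c. computes c d p f" by blast
qed

lemma ptime_id: "ptime (\<lambda>x. x)"
  by (rule ptime_Assign[where e = Var and p = "\<lambda>n. n"]) (auto intro: poly_bounded_intros)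

lemma ptime_Leaf: "ptime (\<lambda>_. Leaf)"
  by (rule ptime_Assign[where e = "\<lambda>_. ELeaf" and p = "\<lambda>n. 1"]) (auto intro: poly_bounded_intros)

lemma ptime_left0: "ptime left"
  by (rule ptime_Assign[where e = "\<lambda>d. ELeft (Var d)" and p = "\<lambda>n. n + n"])
    (simp_all add: tsize_left trans_le_add1 poly_bounded_intros)

lemma ptime_right0: "ptime right"
  by (rule ptime_Assign[where e = "\<lambda>d. ERight (Var d)" and p = "\<lambda>n. n + n"])
    (simp_all add: tsize_right trans_le_add1 poly_bounded_intros)

lemma tsize_enc_bool: "tsize (enc_bool b) \<le> 3"
  by (cases b) auto

lemma ptime_eq0: "ptime (\<lambda>x. enc_bool (left x = right x))"
proof (rule ptime_Assign[where e = "\<lambda>d. EEq (ELeft (Var d)) (ERight (Var d))"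
        and p = "\<lambda>n. n + n + n + n + 3"])
  show "cost (EEq (ELeft (Var d)) (ERight (Var d))) s
    \<le> tsize (s d) + tsize (s d) + tsize (s d) + tsize (s d) + 3" for s d
    using tsize_left[of "s d"] tsize_right[of "s d"] tsize_enc_bool[of "left (s d) = right (s d)"]
    by simp
  show "tsize (enc_bool (left x = right x)) \<le> tsize x + tsize x + tsize x + tsize x + 3" for x
    using tsize_enc_bool[of "left x = right x"] by simp
qed (auto intro!: poly_bounded_intros)

lemma ptime_comp:
  assumes "ptime f" "ptime g"
  shows "ptime (\<lambda>x. f (g x))"
proof -
  obtain p where p: "poly_bounded p" "\<And>x. tsize (f x) \<le> p (tsize x)" "\<And>d. \<exists>c. computes c d p f"
    using assms(1) that by (rule ptimeE)
  obtain q where q: "poly_bounded q" "\<And>x. tsize (g x) \<le> q (tsize x)" "\<And>d. \<exists>c. computes c d q g"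
    using assms(2) that by (rule ptimeE)
  have le: "p (tsize (g x)) \<le> p (q (tsize x))" for x
    by (rule poly_bounded_mono[OF p(1) q(2)])
  show ?thesis
  proof (rule ptimeI)
    show "poly_bounded (\<lambda>n. p (q n) + q n)"
      by (rule poly_bounded_add[OF poly_bounded_comp[OF p(1) q(1)] q(1)])
    show "tsize (f (g x)) \<le> p (q (tsize x)) + q (tsize x)" for x
      using p(2)[of "g x"] le[of x] by linarith
    fix d
    obtain c c' where c: "computes c d p f" "computes c' d q g" using p(3) q(3) by metis
    have "computes (Seq c' c) d (\<lambda>n. p (q n) + q n) (\<lambda>x. f (g x))"
      unfolding computes_def
    proof
      fix s :: state
      obtain t s1 where 1: "exec c' s t s1" "s1 d = g (s d)" "\<forall>i<d. s1 i = s i" "t \<le> q (tsize (s d))"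
        using c(2) that by (rule computesE)
      obtain t' s2 where 2: "exec c s1 t' s2" "s2 d = f (s1 d)" "\<forall>i<d. s2 i = s1 i"
          "t' \<le> p (tsize (s1 d))"
        using c(1) that by (rule computesE)
      show "\<exists>t s'. exec (Seq c' c) s t s' \<and> s' d = f (g (s d)) \<and> (\<forall>i<d. s' i = s i) \<and>
          t \<le> p (q (tsize (s d))) + q (tsize (s d))"
        using exec.Seq[OF 1(1) 2(1)] 1 2 le[of "s d"]
        by (intro exI[of _ "t + t'"] exI[of _ s2]) auto
    qed
    then show "\<exists>c. computes c d (\<lambda>n. p (q n) + q n) (\<lambda>x. f (g x))" by blast
  qed
qed

text \<open>The input has to survive the first computation, and the first result the second. So the
  input is copied upwards: \<open>c\<close> works at \<open>d + 1\<close>, then \<open>c'\<close> at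
  \<open>d + 2\<close>, and each leaves the registers below its own unchanged.\<close>

lemma ptime_Node:
  assumes "ptime f" "ptime g"
  shows "ptime (\<lambda>x. Node (f x) (g x))"
proof -
  obtain p where p: "poly_bounded p" "\<And>x. tsize (f x) \<le> p (tsize x)" "\<And>d. \<exists>c. computes c d p f"
    using assms(1) that by (rule ptimeE)
  obtain q where q: "poly_bounded q" "\<And>x. tsize (g x) \<le> q (tsize x)" "\<And>d. \<exists>c. computes c d q g"
    using assms(2) that by (rule ptimeE)
  let ?r = "\<lambda>n. 3 * (p n + q n) + 2 * n + 1"
  show ?thesis
  proof (rule ptimeI)
    show "poly_bounded ?r"
      by (intro poly_bounded_intros p q)
    show "tsize (Node (f x) (g x)) \<le> ?r (tsize x)" for x
      using p(2)[of x] q(2)[of x] by simp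
    fix d
    obtain c where c: "computes c (d + 1) p f" using p(3) by blast
    obtain c' where c': "computes c' (d + 2) q g" using q(3) by blast
    let ?c = "Seq (Assign (d + 1) (Var d)) (Seq c (Seq (Assign (d + 2) (Var d)) (Seq c'
      (Assign d (ENode (Var (d + 1)) (Var (d + 2)))))))"
    have "computes ?c d ?r (\<lambda>x. Node (f x) (g x))"
      unfolding computes_def
    proof
      fix s :: state
      let ?s1 = "s(d + 1 := s d)"
      obtain t2 s2 where 2: "exec c ?s1 t2 s2" "s2 (d + 1) = f (?s1 (d + 1))"
          "\<forall>i<d+1. s2 i = ?s1 i" "t2 \<le> p (tsize (?s1 (d + 1)))"
        using c that by (rule computesE)
      let ?s3 = "s2(d + 2 := s2 d)"
      obtain t4 s4 where 4: "exec c' ?s3 t4 s4" "s4 (d + 2) = g (?s3 (d + 2))"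
          "\<forall>i<d+2. s4 i = ?s3 i" "t4 \<le> q (tsize (?s3 (d + 2)))"
        using c' that by (rule computesE)
      let ?s5 = "s4(d := Node (s4 (d + 1)) (s4 (d + 2)))"
      have e: "exec ?c s (cost (Var d) s + (t2 + (cost (Var d) s2 + (t4 +
          cost (ENode (Var (d + 1)) (Var (d + 2))) s4)))) ?s5"
        by (intro exec.Seq[OF exec_Assign exec.Seq[OF 2(1)
            exec.Seq[OF exec_Assign exec.Seq[OF 4(1) exec_Assign]]]]) auto
      show "\<exists>t s'. exec ?c s t s' \<and> s' d = Node (f (s d)) (g (s d)) \<and> (\<forall>i<d. s' i = s i) \<and>
          t \<le> ?r (tsize (s d))"
        by (intro exI conjI, rule e) (use 2 4 p(2)[of "s d"] q(2)[of "s d"] in auto)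
    qed
    then show "\<exists>c. computes c d ?r (\<lambda>x. Node (f x) (g x))" by blast
  qed
qed

lemma ptime_left: "ptime f \<Longrightarrow> ptime (\<lambda>x. left (f x))"
  and ptime_right: "ptime f \<Longrightarrow> ptime (\<lambda>x. right (f x))"
  by (rule ptime_comp; simp add: ptime_left0 ptime_right0)+

lemma ptime_eq: "ptime f \<Longrightarrow> ptime g \<Longrightarrow> ptime (\<lambda>x. enc_bool (f x = g x))"
  using ptime_comp[OF ptime_eq0 ptime_Node, of f g] by simp

lemma ptime_if:
  assumes "ptime (\<lambda>x. enc_bool (P x))" "ptime f" "ptime g"
  shows "ptime (\<lambda>x. if P x then f x else g x)"
proof -
  obtain p where p: "poly_bounded p" "\<And>x. tsize (f x) \<le> p (tsize x)" "\<And>d. \<exists>c. computes c d p f"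
    using assms(2) that by (rule ptimeE)
  obtain q where q: "poly_bounded q" "\<And>x. tsize (g x) \<le> q (tsize x)" "\<And>d. \<exists>c. computes c d q g"
    using assms(3) that by (rule ptimeE)
  obtain r where r: "poly_bounded r" "\<And>x. tsize (enc_bool (P x)) \<le> r (tsize x)"
     "\<And>d. \<exists>c. computes c d r (\<lambda>x. enc_bool (P x))"
    using assms(1) that by (rule ptimeE)
  let ?r = "\<lambda>n. p n + q n + r n + n + 3"
  show ?thesis
  proof (rule ptimeI)
    show "poly_bounded ?r"
      by (intro poly_bounded_intros p q r)
    show "tsize (if P x then f x else g x) \<le> ?r (tsize x)" for x
      using p(2)[of x] q(2)[of x] by simp
    fix d
    obtain c1 where c1: "computes c1 (d + 1) r (\<lambda>x. enc_bool (P x))" using r(3) by blast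
    obtain c2 c3 where c2: "computes c2 d p f" and c3: "computes c3 d q g" using p(3) q(3) by metis
    let ?c = "Seq (Assign (d + 1) (Var d)) (Seq c1 (If (Var (d + 1)) c2 c3))"
    have "computes ?c d ?r (\<lambda>x. if P x then f x else g x)"
      unfolding computes_def
    proof
      fix s :: state
      let ?s1 = "s(d + 1 := s d)"
      obtain t2 s2 where 2: "exec c1 ?s1 t2 s2" "s2 (d + 1) = enc_bool (P (?s1 (d + 1)))"
          "\<forall>i<d+1. s2 i = ?s1 i" "t2 \<le> r (tsize (?s1 (d + 1)))"
        using c1 that by (rule computesE)
      obtain t3 s3 where 3: "exec c2 s2 t3 s3" "s3 d = f (s2 d)"
          "\<forall>i<d. s3 i = s2 i" "t3 \<le> p (tsize (s2 d))"
        using c2 that by (rule computesE)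
      obtain t4 s4 where 4: "exec c3 s2 t4 s4" "s4 d = g (s2 d)"
          "\<forall>i<d. s4 i = s2 i" "t4 \<le> q (tsize (s2 d))"
        using c3 that by (rule computesE)
      have e: "exec ?c s (cost (Var d) s + (t2 + (cost (Var (d + 1)) s2 +
          (if P (s d) then t3 else t4)))) (if P (s d) then s3 else s4)"
      proof (rule exec.Seq[OF exec_Assign exec.Seq[OF 2(1)]])
        show "exec (If (Var (d + 1)) c2 c3) s2 (cost (Var (d + 1)) s2 + (if P (s d) then t3 else t4))
          (if P (s d) then s3 else s4)"
          using exec.IfTrue[OF _ 3(1), of "Var (d + 1)" c3] exec.IfFalse[OF _ 4(1), of "Var (d + 1)" c2] 2(2)
          by (simp del: cost.simps)
      qed auto
      show "\<exists>t s'. exec ?c s t s' \<and> s' d = (if P (s d) then f (s d) else g (s d)) \<and>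
          (\<forall>i<d. s' i = s i) \<and> t \<le> ?r (tsize (s d))"
        by (intro exI conjI, rule e) (use 2 3 4 tsize_enc_bool[of "P (s d)"] in auto)
    qed
    then show "\<exists>c. computes c d ?r (\<lambda>x. if P x then f x else g x)" by blast
  qed
qed

lemma ptime_size:
  assumes "ptime f"
  obtains p where "poly_bounded p" "\<And>x. tsize (f x) \<le> p (tsize x)"
  using assms by (elim ptimeE) blast

lemma ptime_const: "ptime (\<lambda>_. t)"
  by (induction t) (auto intro: ptime_Leaf ptime_Node)

text \<open>\<open>F\<close> is a total function on trees and has to agree with \<open>f\<close> on
  encodings of elements of \<open>D\<close> only, so no program checks that its input is
  well-formed. Sizes are positive, hence \<open>Suc n \<le> 2 * n\<close>, which trades the base
  \<open>Suc n\<close> for \<open>n\<close> at the price of the factor \<open>2 ^ k\<close>.\<close>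

lemma polytime_onI:
  assumes "ptime F" "\<And>x. x \<in> D \<Longrightarrow> F (enc_in x) = enc_out (f x)"
  shows "polytime_on D enc_in enc_out f"
proof -
  obtain p where p: "poly_bounded p" "\<And>d. \<exists>c. computes c d p F"
    using assms(1) by (rule ptimeE) blast
  obtain c where c: "computes c 0 p F" using p(2) by blast
  obtain a k where ak: "\<And>n. p n \<le> a * Suc n ^ k"
    using p(1) unfolding poly_bounded_def by blast
  have "\<exists>t s'. exec c ((\<lambda>_. Leaf)(0 := enc_in x)) t s' \<and> s' 0 = enc_out (f x) \<and>
      t \<le> (a * 2 ^ k) * tsize (enc_in x) ^ k" if "x \<in> D" for x
  proof -
    let ?s = "(\<lambda>_. Leaf)(0 := enc_in x)"
    have "\<exists>t s'. exec c ?s t s' \<and> s' 0 = F (enc_in x) \<and> t \<le> p (tsize (enc_in x))"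
      using c[unfolded computes_def, THEN spec, of ?s] by auto
    then obtain t s' where e: "exec c ?s t s'" "s' 0 = F (enc_in x)" "t \<le> p (tsize (enc_in x))"
      by blast
    have "Suc (tsize (enc_in x)) ^ k \<le> (2 * tsize (enc_in x)) ^ k"
      using tsize_pos[of "enc_in x"] by (intro power_mono) auto
    then have le: "a * Suc (tsize (enc_in x)) ^ k \<le> (a * 2 ^ k) * tsize (enc_in x) ^ k"
      by (simp add: power_mult_distrib)
    have "t \<le> (a * 2 ^ k) * tsize (enc_in x) ^ k"
      by (rule order_trans[OF e(3) order_trans[OF ak le]])
    with e assms(2)[OF \<open>x \<in> D\<close>] show ?thesis by auto
  qed
  then show ?thesis unfolding polytime_on_def by blast
qed

section \<open>Lists as trees and loops over lists\<close>

fun list_of :: "tree \<Rightarrow> tree list" where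
  "list_of Leaf = []"
| "list_of (Node x t) = x # list_of t"

abbreviation tree_of :: "tree list \<Rightarrow> tree" where
  "tree_of \<equiv> enc_list (\<lambda>x. x)"

lemma list_of_tree_of [simp]: "list_of (tree_of xs) = xs"
  by (induction xs) auto

text \<open>Every tree is the list along its right spine, without exception. So numbers, being lists
  of bits, and encoded lists of any type are processed by the same list operations, and these are
  total.\<close>

lemma tree_of_list_of [simp]: "tree_of (list_of t) = t"
  by (induction t) auto

lemma enc_list_eq: "enc_list e xs = tree_of (map e xs)"
  by (induction xs) auto

lemma list_of_enc_list [simp]: "list_of (enc_list e xs) = map e xs"
  by (induction xs) auto

lemma tsize_tree_of: "tsize (tree_of xs) = Suc (length xs + (\<Sum>x\<leftarrow>xs. tsize x))"
  by (induction xs) auto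

lemma length_list_of: "length (list_of t) < tsize t"
  by (induction t rule: list_of.induct) auto

lemma tsize_list_of: "x \<in> set (list_of t) \<Longrightarrow> tsize x < tsize t"
  by (induction t rule: list_of.induct) auto

text \<open>Register \<open>d\<close> holds a fixed parameter, \<open>d + 1\<close> the rest of the
  list, \<open>d + 2\<close> the accumulator and \<open>d + 3\<close> the packed argument of the
  loop body; \<open>n\<close>, \<open>L\<close> and \<open>M\<close> bound the first three. That
  \<open>F\<close> is computed in polynomial time does not bound the accumulator over many rounds,
  so \<open>M\<close> is assumed for all prefixes of the list.\<close>

lemma exec_fold:
  fixes F :: "tree \<Rightarrow> tree \<Rightarrow> tree \<Rightarrow> tree"
  assumes c: "computes c (d + 3) p (\<lambda>z. F (left z) (left (right z)) (right (right z)))"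
    and p: "poly_bounded p"
    and "s (d + 1) = tree_of xs" "tsize (tree_of xs) \<le> L" "tsize (s d) \<le> n"
    and "\<And>ys zs. xs = ys @ zs \<Longrightarrow> tsize (fold (F (s d)) ys (s (d + 2))) \<le> M"
  shows "\<exists>t s'. exec (While (Var (d + 1))
      (Seq (Assign (d + 3) (ENode (Var d) (ENode (ELeft (Var (d + 1))) (Var (d + 2)))))
      (Seq c (Seq (Assign (d + 2) (Var (d + 3))) (Assign (d + 1) (ERight (Var (d + 1)))))))) s t s' \<and>
    s' (d + 2) = fold (F (s d)) xs (s (d + 2)) \<and> (\<forall>i\<le>d. s' i = s i) \<and>
    t \<le> Suc (length xs) * (p (2 + n + L + M) + 2 * n + 7 * L + 4 * M + 3)"
  using assms(3-6)
proof (induction xs arbitrary: s)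
  case Nil
  then have "exec (While (Var (d + 1)) c') s (cost (Var (d + 1)) s) s" for c'
    by (intro exec.WhileFalse) simp
  then show ?case using Nil by (intro exI conjI) (assumption, auto)
next
  case (Cons x xs)
  let ?b = "Seq (Assign (d + 3) (ENode (Var d) (ENode (ELeft (Var (d + 1))) (Var (d + 2)))))
      (Seq c (Seq (Assign (d + 2) (Var (d + 3))) (Assign (d + 1) (ERight (Var (d + 1))))))"
  let ?s1 = "s(d + 3 := Node (s d) (Node x (s (d + 2))))"
  have acc: "tsize (s (d + 2)) \<le> M" using Cons.prems(4)[of "[]"] by simp
  have acc': "tsize (F (s d) x (s (d + 2))) \<le> M" using Cons.prems(4)[of "[x]"] by simp
  have x: "Suc (tsize x) \<le> L" and xs: "tsize (tree_of xs) \<le> L" using Cons.prems(2) by auto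
  obtain t2 s2 where 2: "exec c ?s1 t2 s2" "s2 (d + 3) = F (s d) x (s (d + 2))"
    "\<forall>i<d+3. s2 i = ?s1 i" "t2 \<le> p (tsize (?s1 (d + 3)))"
    using computesE[OF c, of ?s1] by auto
  have "t2 \<le> p (2 + n + L + M)"
    using 2(4) by (rule order_trans) (use x acc Cons.prems(3) in \<open>auto intro!: poly_bounded_mono[OF p]\<close>)
  moreover
  let ?s3 = "s2(d + 2 := s2 (d + 3))"
  let ?s4 = "?s3(d + 1 := tree_of xs)"
  let ?tb = "cost (ENode (Var d) (ENode (ELeft (Var (d + 1))) (Var (d + 2)))) s +
    (t2 + (cost (Var (d + 3)) s2 + cost (ERight (Var (d + 1))) ?s3))"
  have b: "exec ?b s ?tb ?s4"
    using Cons.prems(1) 2(3)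
    by (intro exec.Seq[OF exec_Assign exec.Seq[OF 2(1) exec.Seq[OF exec_Assign exec_Assign]]]) auto
  \<comment> \<open>The coefficients count how often the parameter, the list and the accumulator are
    charged in one round, including the loop test and the intermediate nodes.\<close>
  ultimately have tb: "cost (Var (d + 1)) s + ?tb \<le> p (2 + n + L + M) + 2 * n + 7 * L + 4 * M + 3"
    using Cons.prems(1-3) 2(2,3) acc acc' x xs by simp
  have s4: "?s4 d = s d" "?s4 (d + 2) = F (s d) x (s (d + 2))" "\<forall>i\<le>d. ?s4 i = s i"
    using 2(2,3) by auto
  have "\<exists>t s'. exec (While (Var (d + 1)) ?b) ?s4 t s' \<and>
      s' (d + 2) = fold (F (?s4 d)) xs (?s4 (d + 2)) \<and> (\<forall>i\<le>d. s' i = ?s4 i) \<and>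
      t \<le> Suc (length xs) * (p (2 + n + L + M) + 2 * n + 7 * L + 4 * M + 3)"
  proof (rule Cons.IH)
    show "?s4 (d + 1) = tree_of xs" by simp
    show "tsize (?s4 d) \<le> n" using s4(1) Cons.prems(3) by simp
    show "tsize (fold (F (?s4 d)) ys (?s4 (d + 2))) \<le> M" if "xs = ys @ zs" for ys zs
      unfolding s4(1,2) using Cons.prems(4)[of "x # ys" zs] that by simp
  qed (rule xs)
  then obtain t s' where w: "exec (While (Var (d + 1)) ?b) ?s4 t s'"
      "s' (d + 2) = fold (F (s d)) xs (F (s d) x (s (d + 2)))" "\<forall>i\<le>d. s' i = s i"
      "t \<le> Suc (length xs) * (p (2 + n + L + M) + 2 * n + 7 * L + 4 * M + 3)"
    unfolding s4(1,2) using s4(3) by auto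
  have "exec (While (Var (d + 1)) ?b) s (cost (Var (d + 1)) s + ?tb + t) s'"
    using Cons.prems(1) by (intro exec.WhileTrue[OF _ b w(1)]) simp
  moreover have "cost (Var (d + 1)) s + ?tb + t
      \<le> Suc (length (x # xs)) * (p (2 + n + L + M) + 2 * n + 7 * L + 4 * M + 3)"
    using add_mono[OF tb w(4)] by (simp only: list.size mult_Suc add_0 add_0_right add_Suc_right)
  ultimately show ?case
    using w(2,3) by (intro exI[of _ "cost (Var (d + 1)) s + ?tb + t"] exI[of _ s']) simp
qed

text \<open>The general form, for loops whose accumulator is small on the runs that occur although a
  single step may enlarge an arbitrary accumulator by much.\<close>

lemma ptime_fold_bounded:
  fixes F :: "tree \<Rightarrow> tree \<Rightarrow> tree \<Rightarrow> tree"
  assumes "ptime (\<lambda>z. F (left z) (left (right z)) (right (right z)))" "ptime G" "ptime I"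
    and q: "poly_bounded q"
    and bound: "\<And>t ys zs. list_of (G t) = ys @ zs \<Longrightarrow> tsize (fold (F t) ys (I t)) \<le> q (tsize t)"
  shows "ptime (\<lambda>t. fold (F t) (list_of (G t)) (I t))"
proof -
  obtain p where p: "poly_bounded p"
    "\<And>d. \<exists>c. computes c d p (\<lambda>z. F (left z) (left (right z)) (right (right z)))"
    using assms(1) by (rule ptimeE) blast
  obtain pG where G: "poly_bounded pG" "\<And>x. tsize (G x) \<le> pG (tsize x)" "\<And>d. \<exists>c. computes c d pG G"
    using assms(2) that by (rule ptimeE)
  obtain pI where I: "poly_bounded pI" "\<And>x. tsize (I x) \<le> pI (tsize x)" "\<And>d. \<exists>c. computes c d pI I"
    using assms(3) that by (rule ptimeE)
  let ?W = "\<lambda>n. Suc (pG n) * (p (2 + n + pG n + q n) + 2 * n + 7 * pG n + 4 * q n + 3)"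
  let ?r = "\<lambda>n. 2 * n + pG n + pI n + ?W n + q n"
  show ?thesis
  proof (rule ptimeI)
    have W: "poly_bounded ?W"
      unfolding Suc_eq_plus1
      by (intro poly_bounded_intros poly_bounded_comp[OF p(1), of "\<lambda>n. 2 + n + pG n + q n"] G I q)
    show "poly_bounded ?r"
      by (intro poly_bounded_add poly_bounded_mult[OF poly_bounded_const poly_bounded_id] W G I q)
    show "tsize (fold (F t) (list_of (G t)) (I t)) \<le> ?r (tsize t)" for t
      using bound[of t _ "[]"] by (simp add: trans_le_add2)
    fix d
    obtain c where c: "computes c (d + 3) p (\<lambda>z. F (left z) (left (right z)) (right (right z)))"
      using p(2) by blast
    obtain cG where cG: "computes cG (d + 1) pG G" using G(3) by blast
    obtain cI where cI: "computes cI (d + 2) pI I" using I(3) by blast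
    let ?w = "While (Var (d + 1))
      (Seq (Assign (d + 3) (ENode (Var d) (ENode (ELeft (Var (d + 1))) (Var (d + 2)))))
      (Seq c (Seq (Assign (d + 2) (Var (d + 3))) (Assign (d + 1) (ERight (Var (d + 1)))))))"
    let ?c = "Seq (Assign (d + 1) (Var d)) (Seq cG (Seq (Assign (d + 2) (Var d)) (Seq cI
      (Seq ?w (Assign d (Var (d + 2)))))))"
    have "computes ?c d ?r (\<lambda>t. fold (F t) (list_of (G t)) (I t))"
      unfolding computes_def
    proof
      fix s :: state
      let ?s1 = "s(d + 1 := s d)"
      obtain t2 s2 where 2: "exec cG ?s1 t2 s2" "s2 (d + 1) = G (?s1 (d + 1))"
          "\<forall>i<d+1. s2 i = ?s1 i" "t2 \<le> pG (tsize (?s1 (d + 1)))"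
        using cG that by (rule computesE)
      let ?s3 = "s2(d + 2 := s2 d)"
      obtain t4 s4 where 4: "exec cI ?s3 t4 s4" "s4 (d + 2) = I (?s3 (d + 2))"
          "\<forall>i<d+2. s4 i = ?s3 i" "t4 \<le> pI (tsize (?s3 (d + 2)))"
        using cI that by (rule computesE)
      have s4: "s4 d = s d" "s4 (d + 1) = G (s d)" "s4 (d + 2) = I (s d)" "\<forall>i<d. s4 i = s i"
        using 2 4 by auto
      have "\<exists>t s'. exec ?w s4 t s' \<and>
        s' (d + 2) = fold (F (s4 d)) (list_of (G (s d))) (s4 (d + 2)) \<and> (\<forall>i\<le>d. s' i = s4 i) \<and>
        t \<le> Suc (length (list_of (G (s d)))) *
          (p (2 + tsize (s d) + pG (tsize (s d)) + q (tsize (s d))) + 2 * tsize (s d)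
            + 7 * pG (tsize (s d)) + 4 * q (tsize (s d)) + 3)"
        using bound s4 G(2) by (intro exec_fold[OF c p(1)]) auto
      then obtain t5 s5 where 5: "exec ?w s4 t5 s5"
        "s5 (d + 2) = fold (F (s d)) (list_of (G (s d))) (I (s d))" "\<forall>i\<le>d. s5 i = s4 i"
        "t5 \<le> Suc (length (list_of (G (s d)))) *
          (p (2 + tsize (s d) + pG (tsize (s d)) + q (tsize (s d))) + 2 * tsize (s d)
            + 7 * pG (tsize (s d)) + 4 * q (tsize (s d)) + 3)"
        unfolding s4 by blast
      have "length (list_of (G (s d))) \<le> pG (tsize (s d))"
        using length_list_of[of "G (s d)"] G(2)[of "s d"] by linarith
      then have t5: "t5 \<le> ?W (tsize (s d))"
        using 5(4) by (elim order_trans) (intro mult_le_mono1, simp)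
      have e: "exec ?c s (cost (Var d) s + (t2 + (cost (Var d) s2 + (t4 +
          (t5 + cost (Var (d + 2)) s5))))) (s5(d := s5 (d + 2)))"
        by (intro exec.Seq[OF exec_Assign exec.Seq[OF 2(1) exec.Seq[OF exec_Assign
            exec.Seq[OF 4(1) exec.Seq[OF 5(1) exec_Assign]]]]]) auto
      have "cost (Var d) s + (t2 + (cost (Var d) s2 + (t4 + (t5 + cost (Var (d + 2)) s5))))
        \<le> ?r (tsize (s d))"
      proof -
        have "cost (Var (d + 2)) s5 \<le> q (tsize (s d))"
          using bound[of "s d" _ "[]"] 5(2) by simp
        moreover have "t2 \<le> pG (tsize (s d))" "t4 \<le> pI (tsize (s d))" "s2 d = s d" using 2 4 by auto
        ultimately show ?thesis using t5 by simp
      qed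
      with 5 s4(4) show "\<exists>t s'. exec ?c s t s' \<and> s' d = fold (F (s d)) (list_of (G (s d))) (I (s d)) \<and>
          (\<forall>i<d. s' i = s i) \<and> t \<le> ?r (tsize (s d))"
        by - (intro exI conjI, rule e, auto simp del: cost.simps mult_Suc)
    qed
    then show "\<exists>c. computes c d ?r (\<lambda>t. fold (F t) (list_of (G t)) (I t))" by blast
  qed
qed

text \<open>If one step adds an amount bounded in terms of the input \<open>t\<close> alone, the
  accumulator grows by at most that amount times the length of the list. This excludes repeated
  doubling and is easy to check.\<close>

lemma ptime_fold:
  fixes F :: "tree \<Rightarrow> tree \<Rightarrow> tree \<Rightarrow> tree"
  assumes F: "ptime (\<lambda>z. F (left z) (left (right z)) (right (right z)))" and "ptime G" "ptime I"
    and q: "poly_bounded q"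
    and add: "\<And>t x acc. x \<in> set (list_of (G t)) \<Longrightarrow> tsize (F t x acc) \<le> tsize acc + q (tsize t)"
  shows "ptime (\<lambda>t. fold (F t) (list_of (G t)) (I t))"
proof -
  obtain pG where G: "poly_bounded pG" "\<And>x. tsize (G x) \<le> pG (tsize x)"
    using assms(2) that by (rule ptime_size)
  obtain pI where I: "poly_bounded pI" "\<And>x. tsize (I x) \<le> pI (tsize x)"
    using assms(3) that by (rule ptime_size)
  show ?thesis
  proof (rule ptime_fold_bounded[OF assms(1-3)])
    show "poly_bounded (\<lambda>n. pI n + pG n * q n)"
      by (intro poly_bounded_intros G I q)
    fix t ys zs
    assume ys: "list_of (G t) = ys @ zs"
    have "tsize (fold (F t) ys acc) \<le> tsize acc + length ys * q (tsize t)"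
      if "set ys \<subseteq> set (list_of (G t))" for acc ys
      using that
    proof (induction ys arbitrary: acc)
      case (Cons y ys)
      then have "tsize (fold (F t) ys (F t y acc)) \<le> tsize (F t y acc) + length ys * q (tsize t)"
        by simp
      also have "tsize (F t y acc) \<le> tsize acc + q (tsize t)"
        using add Cons.prems by simp
      finally show ?case by simp
    qed simp
    then have "tsize (fold (F t) ys (I t)) \<le> tsize (I t) + length ys * q (tsize t)"
      using ys by simp
    also have "\<dots> \<le> pI (tsize t) + pG (tsize t) * q (tsize t)"
      using length_list_of[of "G t"] G(2)[of t] I(2)[of t] ys
      by (intro add_mono mult_le_mono1) auto
    finally show "tsize (fold (F t) ys (I t)) \<le> pI (tsize t) + pG (tsize t) * q (tsize t)" .
  qed
qed

lemma ptime_rev: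
  assumes "ptime G"
  shows "ptime (\<lambda>t. tree_of (rev (list_of (G t))))"
proof -
  obtain p where p: "poly_bounded p" "\<And>x. tsize (G x) \<le> p (tsize x)"
    using assms that by (rule ptime_size)
  have "ptime (\<lambda>t. fold (\<lambda>x acc. Node x acc) (list_of (G t)) Leaf)"
  proof (rule ptime_fold[OF _ assms ptime_Leaf])
    show "ptime (\<lambda>z. Node (left (right z)) (right (right z)))"
      by (intro ptime_Node ptime_left ptime_right ptime_id)
    show "poly_bounded (\<lambda>n. p n + 1)" by (intro poly_bounded_intros p)
    show "tsize (Node x acc) \<le> tsize acc + (p (tsize t) + 1)" if "x \<in> set (list_of (G t))" for t x acc
      using tsize_list_of[OF that] p(2)[of t] by simp
  qed
  moreover have "fold Node xs u = tree_of (rev xs @ list_of u)" for xs u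
    by (induction xs arbitrary: u) simp_all
  ultimately show ?thesis by simp
qed

lemma ptime_foldr:
  fixes F :: "tree \<Rightarrow> tree \<Rightarrow> tree \<Rightarrow> tree"
  assumes F: "ptime (\<lambda>z. F (left z) (left (right z)) (right (right z)))" and "ptime G" "ptime I"
    and q: "poly_bounded q"
    and add: "\<And>t x acc. x \<in> set (list_of (G t)) \<Longrightarrow> tsize (F t x acc) \<le> tsize acc + q (tsize t)"
  shows "ptime (\<lambda>t. foldr (F t) (list_of (G t)) (I t))"
proof -
  have "ptime (\<lambda>t. fold (F t) (list_of (tree_of (rev (list_of (G t))))) (I t))"
    using add by (intro ptime_fold[OF F ptime_rev[OF assms(2)] assms(3) q]) simp
  then show ?thesis by (simp add: foldr_conv_fold)
qed

text \<open>The mapped function also sees the whole input \<open>t\<close>. In nested loops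
  \<open>left z\<close> thus serves as the environment and \<open>right z\<close> as the current
  element.\<close>

lemma ptime_map:
  assumes "ptime (\<lambda>z. F (left z) (right z))" "ptime G"
  shows "ptime (\<lambda>t. tree_of (map (F t) (list_of (G t))))"
proof -
  obtain p where p: "poly_bounded p" "\<And>x. tsize (F (left x) (right x)) \<le> p (tsize x)"
    using assms(1) that by (rule ptime_size)
  obtain q where q: "poly_bounded q" "\<And>x. tsize (G x) \<le> q (tsize x)"
    using assms(2) that by (rule ptime_size)
  have "ptime (\<lambda>t. foldr (\<lambda>x acc. Node (F t x) acc) (list_of (G t)) Leaf)"
  proof (rule ptime_foldr[OF _ assms(2) ptime_Leaf])
    have "ptime (\<lambda>z. Node (left z) (left (right z)))"
      by (intro ptime_Node ptime_left ptime_right ptime_id)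
    from ptime_comp[OF assms(1) this]
    show "ptime (\<lambda>z. Node (F (left z) (left (right z))) (right (right z)))"
      by (simp add: ptime_Node ptime_left ptime_right ptime_id)
    show "poly_bounded (\<lambda>n. p (n + q n + 1) + 1)"
      by (intro poly_bounded_intros poly_bounded_comp[OF p(1)] q)
    show "tsize (Node (F t x) acc) \<le> tsize acc + (p (tsize t + q (tsize t) + 1) + 1)"
      if "x \<in> set (list_of (G t))" for t x acc
    proof -
      have "tsize (F t x) \<le> p (tsize (Node t x))" using p(2)[of "Node t x"] by simp
      also have "\<dots> \<le> p (tsize t + q (tsize t) + 1)"
        using tsize_list_of[OF that] q(2)[of t] by (intro poly_bounded_mono[OF p(1)]) simp
      finally show ?thesis by simp
    qed
  qed
  moreover have "foldr (\<lambda>x. Node (f x)) xs Leaf = tree_of (map f xs)" for f :: "tree \<Rightarrow> tree" and xs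
    by (induction xs) auto
  ultimately show ?thesis by simp
qed

lemma ptime_filter:
  assumes "ptime (\<lambda>z. enc_bool (P (left z) (right z)))" "ptime G"
  shows "ptime (\<lambda>t. tree_of (filter (P t) (list_of (G t))))"
proof -
  obtain q where q: "poly_bounded q" "\<And>x. tsize (G x) \<le> q (tsize x)"
    using assms(2) that by (rule ptime_size)
  have "ptime (\<lambda>t. foldr (\<lambda>x acc. if P t x then Node x acc else acc) (list_of (G t)) Leaf)"
  proof (rule ptime_foldr[OF _ assms(2) ptime_Leaf])
    have "ptime (\<lambda>z. Node (left z) (left (right z)))"
      by (intro ptime_Node ptime_left ptime_right ptime_id)
    from ptime_comp[OF assms(1) this]
    show "ptime (\<lambda>z. if P (left z) (left (right z)) then Node (left (right z)) (right (right z))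
      else right (right z))"
      by (intro ptime_if ptime_Node ptime_left ptime_right ptime_id) simp
    show "poly_bounded (\<lambda>n. q n + 1)"
      by (intro poly_bounded_intros q)
    show "tsize (if P t x then Node x acc else acc) \<le> tsize acc + (q (tsize t) + 1)"
      if "x \<in> set (list_of (G t))" for t x acc
      using tsize_list_of[OF that] q(2)[of t] by simp
  qed
  moreover have "foldr (\<lambda>x acc. if P x then Node x acc else acc) xs Leaf = tree_of (filter P xs)"
    for P :: "tree \<Rightarrow> bool" and xs
    by (induction xs) auto
  ultimately show ?thesis by simp
qed

lemma ptime_append:
  assumes "ptime G" "ptime I"
  shows "ptime (\<lambda>t. tree_of (list_of (G t) @ list_of (I t)))"
proof -
  obtain q where q: "poly_bounded q" "\<And>x. tsize (G x) \<le> q (tsize x)"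
    using assms(1) that by (rule ptime_size)
  have "ptime (\<lambda>t. foldr Node (list_of (G t)) (I t))"
  proof (rule ptime_foldr[OF _ assms])
    show "ptime (\<lambda>z. Node (left (right z)) (right (right z)))"
      by (intro ptime_Node ptime_left ptime_right ptime_id)
    show "poly_bounded (\<lambda>n. q n + 1)"
      by (intro poly_bounded_intros q)
    show "tsize (Node x acc) \<le> tsize acc + (q (tsize t) + 1)"
      if "x \<in> set (list_of (G t))" for t x acc
      using tsize_list_of[OF that] q(2)[of t] by simp
  qed
  moreover have "foldr Node xs u = tree_of (xs @ list_of u)" for xs u
    by (induction xs) auto
  ultimately show ?thesis by simp
qed

text \<open>All lists are computed before any two are joined, so that each step of the second loop
  adds at most the size of the tree that holds them all.\<close>

lemma ptime_concat:
  assumes "ptime (\<lambda>z. F (left z) (right z))" "ptime G"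
  shows "ptime (\<lambda>t. tree_of (concat (map (\<lambda>x. list_of (F t x)) (list_of (G t)))))"
proof -
  note m = ptime_map[OF assms]
  obtain q where q: "poly_bounded q" "\<And>x. tsize (tree_of (map (F x) (list_of (G x)))) \<le> q (tsize x)"
    using m that by (rule ptime_size)
  have "ptime (\<lambda>t. foldr (\<lambda>x acc. tree_of (list_of x @ list_of acc))
    (list_of (tree_of (map (F t) (list_of (G t))))) Leaf)"
  proof (rule ptime_foldr[OF _ m ptime_Leaf])
    show "ptime (\<lambda>z. tree_of (list_of (left (right z)) @ list_of (right (right z))))"
      by (intro ptime_append ptime_left ptime_right ptime_id)
    show "poly_bounded q" by fact
    show "tsize (tree_of (list_of x @ list_of acc)) \<le> tsize acc + q (tsize t)"
      if "x \<in> set (list_of (tree_of (map (F t) (list_of (G t)))))" for t x acc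
    proof -
      have "tsize (tree_of (list_of x @ list_of acc)) < tsize x + tsize acc"
        using tsize_tree_of[of "list_of acc"] tsize_tree_of[of "list_of x"]
          tsize_tree_of[of "list_of x @ list_of acc"] by simp
      with tsize_list_of[OF that] q(2)[of t] show ?thesis by simp
    qed
  qed
  moreover have "foldr (\<lambda>x acc. tree_of (list_of (f x) @ list_of acc)) xs Leaf
     = tree_of (concat (map (\<lambda>x. list_of (f x)) xs))" for f :: "tree \<Rightarrow> tree" and xs
    by (induction xs) auto
  ultimately show ?thesis by (simp add: foldr_map comp_def)
qed

section \<open>Binary numbers\<close>

lemma tsize_list_of_append:
  assumes "list_of t = xs @ ys"
  shows "tsize (tree_of xs) \<le> tsize t" "tsize (tree_of ys) \<le> tsize t"
proof -
  have "t = tree_of (xs @ ys)" by (simp flip: assms)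
  then show "tsize (tree_of xs) \<le> tsize t" "tsize (tree_of ys) \<le> tsize t"
    by (simp_all add: tsize_tree_of)
qed

fun bin_suc :: "tree \<Rightarrow> tree" where
  "bin_suc Leaf = Node (Node Leaf Leaf) Leaf"
| "bin_suc (Node x t) = (if x = Leaf then Node (Node Leaf Leaf) t else Node Leaf (bin_suc t))"

lemma enc_nat_0 [simp]: "enc_nat 0 = Leaf"
  by (simp add: enc_nat.simps)

lemma enc_nat_double: "0 < n \<or> b \<Longrightarrow> enc_nat (2 * n + of_bool b) = Node (enc_bool b) (enc_nat n)"
  by (subst enc_nat.simps) auto

lemma bin_suc_enc_nat [simp]: "bin_suc (enc_nat n) = enc_nat (Suc n)"
proof (induction n rule: less_induct)
  case (less n)
  show ?case
  proof (cases "n = 0")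
    case False
    then have "bin_suc (enc_nat (n div 2)) = enc_nat (Suc (n div 2))"
      by (intro less.IH) simp
    with False show ?thesis
      by (cases "even n") (simp_all add: enc_nat.simps[of n] enc_nat.simps[of "Suc n"])
  qed (simp add: enc_nat.simps)
qed

lemma tsize_bin_suc: "tsize (bin_suc t) \<le> tsize t + 4"
proof (induction t rule: bin_suc.induct)
  case (2 x t)
  then show ?case using tsize_pos[of x] by auto
qed auto

text \<open>A zero bit stops the carry, and the higher bits then stay as they were. A loop from the
  most significant bit downwards must therefore carry a pair: the bits read so far and their
  successor.\<close>

lemma ptime_bin_suc:
  assumes "ptime f"
  shows "ptime (\<lambda>t. bin_suc (f t))"
proof -
  let ?F = "\<lambda>x acc. Node (Node x (left acc))
    (if x = Leaf then Node (Node Leaf Leaf) (left acc) else Node Leaf (right acc))"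
  let ?I = "Node Leaf (bin_suc Leaf)"
  have fold: "foldr ?F xs ?I = Node (tree_of xs) (bin_suc (tree_of xs))" for xs
    by (induction xs) auto
  obtain p where p: "poly_bounded p" "\<And>x. tsize (f x) \<le> p (tsize x)"
    using assms that by (rule ptime_size)
  have "ptime (\<lambda>t. fold ?F (list_of (tree_of (rev (list_of (f t))))) ?I)"
  proof (rule ptime_fold_bounded[OF _ ptime_rev[OF assms] ptime_const])
    show "ptime (\<lambda>z. Node (Node (left (right z)) (left (right (right z))))
     (if left (right z) = Leaf then Node (Node Leaf Leaf) (left (right (right z)))
      else Node Leaf (right (right (right z)))))"
      by (intro ptime_Node ptime_if ptime_eq ptime_left ptime_right ptime_id ptime_Leaf)
    show "poly_bounded (\<lambda>n. 2 * p n + 5)"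
      by (intro poly_bounded_intros p)
    fix t ys zs
    assume "list_of (tree_of (rev (list_of (f t)))) = ys @ zs"
    then have "list_of (f t) = rev zs @ rev ys" by (simp add: rev_eq_append_conv)
    then have "tsize (tree_of (rev ys)) \<le> tsize (f t)"
      by (rule tsize_list_of_append)
    moreover have "fold ?F ys ?I = Node (tree_of (rev ys)) (bin_suc (tree_of (rev ys)))"
      using fold[of "rev ys"] by (simp add: foldr_conv_fold)
    ultimately show "tsize (fold ?F ys ?I) \<le> 2 * p (tsize t) + 5"
      using tsize_bin_suc[of "tree_of (rev ys)"] p(2)[of t] by simp
  qed
  from ptime_right[OF this] show ?thesis
    using fold by (simp add: foldr_conv_fold)
qed

text \<open>Lists serve as unary numbers, so that addition is concatenation. Counting up in binary
  is affordable because the length of a list is below the size of its tree.\<close>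

definition bin :: "tree \<Rightarrow> tree" where
  "bin t = fold (\<lambda>_. bin_suc) (list_of t) Leaf"

lemma bin_eq: "bin t = enc_nat (length (list_of t))"
proof -
  have "fold (\<lambda>_. bin_suc) xs (enc_nat k) = enc_nat (k + length xs)" for xs :: "tree list" and k
    by (induction xs arbitrary: k) auto
  from this[of _ 0] show ?thesis by (simp add: bin_def)
qed

lemma ptime_bin:
  assumes "ptime f"
  shows "ptime (\<lambda>t. bin (f t))"
  unfolding bin_def
proof (rule ptime_fold[OF _ assms ptime_Leaf])
  show "ptime (\<lambda>z. bin_suc (right (right z)))"
    by (intro ptime_bin_suc ptime_right ptime_id)
  show "tsize (bin_suc acc) \<le> tsize acc + 4" for acc by (rule tsize_bin_suc)
qed (rule poly_bounded_const)

definition unary :: "nat \<Rightarrow> tree" where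
  "unary n = tree_of (replicate n Leaf)"

lemma length_unary [simp]: "length (list_of (unary n)) = n"
  by (simp add: unary_def)

definition number :: "tree \<Rightarrow> tree" where
  "number t = tree_of (map (\<lambda>(i, x). Node (unary i) x) (enumerate 0 (list_of t)))"

lemma list_of_number [simp]:
  "list_of (number t) = map (\<lambda>(i, x). Node (unary i) x) (enumerate 0 (list_of t))"
  by (simp add: number_def)

text \<open>The accumulator pairs a unary counter with the reversed output. Every step copies the
  counter, so a step is not additive for arbitrary accumulators; starting from zero, however, the
  copies have quadratic total size.\<close>

lemma ptime_number:
  assumes "ptime f"
  shows "ptime (\<lambda>t. number (f t))"
proof -
  let ?F = "\<lambda>x acc. Node (Node Leaf (left acc)) (Node (Node (left acc) x) (right acc))"
  let ?m = "map (\<lambda>(i, x). Node (unary i) x)"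
  have fold: "fold ?F xs (Node (unary k) u) =
      Node (unary (k + length xs)) (tree_of (rev (?m (enumerate k xs)) @ list_of u))" for k u xs
  proof (induction xs arbitrary: k u)
    case (Cons x xs)
    from Cons.IH[of "Suc k" "Node (Node (unary k) x) u"] show ?case by (simp add: unary_def)
  qed simp
  have size: "tsize (fold ?F xs (Node c u)) \<le>
    1 + tsize u + tsize c + length xs * (tsize c + 2 * length xs + 4) + tsize (tree_of xs)" for xs c u
  proof (induction xs arbitrary: c u)
    case (Cons x xs)
    from Cons.IH[of "Node Leaf c" "Node (Node c x) u"] show ?case
      by (simp add: algebra_simps)
  qed simp
  obtain p where p: "poly_bounded p" "\<And>x. tsize (f x) \<le> p (tsize x)"
    using assms that by (rule ptime_size)
  have "ptime (\<lambda>t. fold ?F (list_of (f t)) (Node Leaf Leaf))"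
  proof (rule ptime_fold_bounded[OF _ assms ptime_const])
    show "ptime (\<lambda>z. Node (Node Leaf (left (right (right z))))
      (Node (Node (left (right (right z))) (left (right z))) (right (right (right z)))))"
      by (intro ptime_Node ptime_left ptime_right ptime_id ptime_Leaf)
    show "poly_bounded (\<lambda>n. 3 + p n * (2 * p n + 5) + p n)"
      by (intro poly_bounded_intros p)
    fix t ys zs
    assume ys: "list_of (f t) = ys @ zs"
    then have le: "length ys \<le> p (tsize t)" "tsize (tree_of ys) \<le> p (tsize t)"
      using length_list_of[of "f t"] p(2)[of t] tsize_list_of_append[OF ys]
      by simp_all
    then have "length ys * (2 * length ys + 5) \<le> p (tsize t) * (2 * p (tsize t) + 5)"
      by (intro mult_le_mono) auto
    with size[of ys Leaf Leaf] le
    show "tsize (fold ?F ys (Node Leaf Leaf)) \<le> 3 + p (tsize t) * (2 * p (tsize t) + 5) + p (tsize t)"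
      by (simp add: algebra_simps)
  qed
  from ptime_rev[OF ptime_right[OF this]] fold[of _ 0 Leaf] show ?thesis
    by (simp add: unary_def number_def)
qed

text \<open>With the least significant bit first, a power of two is a list of zero bits, one for
  each unit of the exponent, followed by a one.\<close>

definition power_two :: "tree \<Rightarrow> tree" where
  "power_two t = tree_of (list_of (tree_of (map (\<lambda>_. Leaf) (list_of t))) @ list_of (Node (Node Leaf Leaf) Leaf))"

lemma power_two_eq: "power_two t = enc_nat (2 ^ length (list_of t))"
proof -
  have "tree_of (map (\<lambda>_. Leaf) xs @ [Node Leaf Leaf]) = enc_nat (2 ^ length xs)" for xs :: "tree list"
  proof (induction xs)
    case Nil
    show ?case using enc_nat_double[of 0 True] by simp
  next
    case (Cons x xs)
    then show ?case using enc_nat_double[of "2 ^ length xs" False] by simp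
  qed
  then show ?thesis by (simp add: power_two_def)
qed

lemma ptime_power_two: "ptime f \<Longrightarrow> ptime (\<lambda>t. power_two (f t))"
  unfolding power_two_def by (intro ptime_append ptime_map ptime_const)

definition tree_append :: "tree \<Rightarrow> tree \<Rightarrow> tree" where
  "tree_append s t = tree_of (list_of s @ list_of t)"

lemma list_of_tree_append [simp]: "list_of (tree_append s t) = list_of s @ list_of t"
  by (simp add: tree_append_def)

lemma ptime_tree_append: "ptime f \<Longrightarrow> ptime g \<Longrightarrow> ptime (\<lambda>t. tree_append (f t) (g t))"
  unfolding tree_append_def by (rule ptime_append)

lemmas ptime_intros = ptime_id ptime_const ptime_left ptime_right ptime_Node ptime_if ptime_eq
  ptime_map ptime_filter ptime_concat ptime_bin_suc ptime_bin ptime_number ptime_power_two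
  ptime_tree_append

text \<open>Justifies that the programs compare bank numbers by comparing their encodings.\<close>

lemma enc_nat_inject: "enc_nat m = enc_nat n \<longleftrightarrow> m = n"
proof
  show "enc_nat m = enc_nat n \<Longrightarrow> m = n"
  proof (induction m arbitrary: n rule: less_induct)
    case (less m)
    show ?case
    proof (cases "m = 0 \<or> n = 0")
      case True
      then show ?thesis using less.prems by (auto simp: enc_nat.simps split: if_splits)
    next
      case False
      then have "enc_nat (m div 2) = enc_nat (n div 2)" and bits: "enc_bool (odd m) = enc_bool (odd n)"
        using less.prems by (simp_all add: enc_nat.simps[of m] enc_nat.simps[of n])
      then have "m div 2 = n div 2" using False by (intro less.IH) auto
      moreover have "odd m \<longleftrightarrow> odd n" using bits by (cases "odd m"; cases "odd n") auto
      ultimately show ?thesis by (metis even_two_times_div_two odd_two_times_div_two_succ)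
    qed
  qed
qed simp

section \<open>Networks from edge lists\<close>

definition rank :: "('a \<Rightarrow> bool) \<Rightarrow> 'a list \<Rightarrow> nat \<Rightarrow> nat" where
  "rank P xs k = length (filter P (take k xs))"

lemma nth_filter_rank:
  assumes "k < length xs" "P (xs ! k)"
  shows "rank P xs k < length (filter P xs)" "filter P xs ! rank P xs k = xs ! k"
proof -
  have "filter P xs = filter P (take k xs) @ xs ! k # filter P (drop (Suc k) xs)"
    using assms by (subst id_take_nth_drop[OF assms(1)]) simp
  then show "rank P xs k < length (filter P xs)" "filter P xs ! rank P xs k = xs ! k"
    by (simp_all add: rank_def)
qed

lemma rank_strict_mono:
  assumes "k < k'" "k' < length xs" "P (xs ! k)"
  shows "rank P xs k < rank P xs k'"
proof -
  have "rank P (take k' xs) k < length (filter P (take k' xs))"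
    using assms by (intro nth_filter_rank) simp_all
  then show ?thesis using assms(1) by (simp add: rank_def min_def)
qed

lemma rank_surj:
  "i < length (filter P xs) \<Longrightarrow> \<exists>k<length xs. P (xs ! k) \<and> rank P xs k = i"
proof (induction xs rule: rev_induct)
  case (snoc x xs)
  show ?case
  proof (cases "i < length (filter P xs)")
    case True
    with snoc.IH obtain k where "k < length xs" "P (xs ! k)" "rank P xs k = i" by blast
    then show ?thesis by (intro exI[of _ k]) (simp add: nth_append rank_def)
  next
    case False
    with snoc.prems have "P x" "i = length (filter P xs)" by (auto split: if_splits)
    then show ?thesis by (intro exI[of _ "length xs"]) (simp add: rank_def)
  qed
qed simp

text \<open>Sorting a list into groups by \<open>f\<close> identifies a position of the list with a
  group and a position inside it. For \<open>f = src\<close> and \<open>f = dst\<close> this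
  identifies the edges with the outgoing and with the incoming stubs.\<close>

lemma bij_betw_rank:
  assumes "\<And>x. x \<in> set xs \<Longrightarrow> f x < n"
  shows "bij_betw (\<lambda>k. (f (xs ! k), rank (\<lambda>x. f x = f (xs ! k)) xs k)) {..<length xs}
    (SIGMA u:{..<n}. {..<length (filter (\<lambda>x. f x = u) xs)})" (is "bij_betw ?g ?A ?B")
  unfolding bij_betw_def
proof
  show "inj_on ?g ?A"
  proof (rule linorder_inj_onI)
    fix k l assume "k < l" "k \<in> ?A" "l \<in> ?A"
    then show "?g k \<noteq> ?g l"
      using rank_strict_mono[of k l xs "\<lambda>x. f x = f (xs ! k)"] by auto
  qed auto
  show "?g ` ?A = ?B"
  proof (intro equalityI subsetI)
    fix p assume "p \<in> ?B"
    then obtain u i where p: "p = (u, i)" "i < length (filter (\<lambda>x. f x = u) xs)" by auto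
    from rank_surj[OF p(2)] show "p \<in> ?g ` ?A"
      unfolding p by (auto intro!: rev_image_eqI)
  qed (auto intro: assms nth_filter_rank)
qed

section \<open>Stub systems and networks of an edge list\<close>

type_synonym edge = "nat \<times> nat \<times> nat"

abbreviation src :: "edge \<Rightarrow> nat" where "src \<equiv> fst"
abbreviation dst :: "edge \<Rightarrow> nat" where "dst e \<equiv> fst (snd e)"
abbreviation wt :: "edge \<Rightarrow> nat" where "wt e \<equiv> snd (snd e)"

definition out_weights :: "edge list \<Rightarrow> nat \<Rightarrow> nat list" where
  "out_weights E u = map wt (filter (\<lambda>e. src e = u) E)"

definition in_weights :: "edge list \<Rightarrow> nat \<Rightarrow> nat list" where
  "in_weights E u = map wt (filter (\<lambda>e. dst e = u) E)"

definition creditors :: "edge list \<Rightarrow> nat \<Rightarrow> nat list" where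
  "creditors E u = map dst (filter (\<lambda>e. src e = u) E)"

text \<open>The order of \<open>E\<close> fixes the ranking: a bank pays its edges in the order in
  which they are listed.\<close>

definition system_of :: "nat \<Rightarrow> (nat \<Rightarrow> nat) \<Rightarrow> edge list \<Rightarrow> stub_system" where
  "system_of n ext E = \<lparr>banks = map (\<lambda>u. \<lparr>external = ext u, outgoing = out_weights E u,
     incoming = in_weights E u\<rparr>) [0..<n], target = 0\<rparr>"

definition network_of :: "nat \<Rightarrow> edge list \<Rightarrow> network" where
  "network_of n E = map (creditors E) [0..<n]"

lemma length_banks_system_of [simp]: "length (banks (system_of n ext E)) = n"
  by (simp add: system_of_def)

lemma target_system_of [simp]: "target (system_of n ext E) = 0"
  by (simp add: system_of_def)

lemma nth_banks_system_of [simp]: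
  "u < n \<Longrightarrow> banks (system_of n ext E) ! u =
    \<lparr>external = ext u, outgoing = out_weights E u, incoming = in_weights E u\<rparr>"
  by (simp add: system_of_def)

lemma nth_network_of [simp]: "u < n \<Longrightarrow> network_of n E ! u = creditors E u"
  by (simp add: network_of_def)

lemma length_network_of [simp]: "length (network_of n E) = n"
  by (simp add: network_of_def)

lemma out_stubs_system_of:
  "out_stubs (system_of n ext E) = (SIGMA u:{..<n}. {..<length (filter (\<lambda>e. src e = u) E)})"
  by (auto simp: out_stubs_def out_weights_def)

lemma in_stubs_system_of:
  "in_stubs (system_of n ext E) = (SIGMA u:{..<n}. {..<length (filter (\<lambda>e. dst e = u) E)})"
  by (auto simp: in_stubs_def in_weights_def)

definition out_stub :: "edge list \<Rightarrow> nat \<Rightarrow> nat \<times> nat" where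
  "out_stub E k = (src (E ! k), rank (\<lambda>e. src e = src (E ! k)) E k)"

definition in_stub :: "edge list \<Rightarrow> nat \<Rightarrow> nat \<times> nat" where
  "in_stub E k = (dst (E ! k), rank (\<lambda>e. dst e = dst (E ! k)) E k)"

lemma nth_creditors:
  "i < length (filter (\<lambda>e. src e = u) E) \<Longrightarrow>
    \<exists>e\<in>set E. src e = u \<and> creditors E u ! i = dst e \<and> out_weights E u ! i = wt e"
  by (rule bexI[of _ "filter (\<lambda>e. src e = u) E ! i"])
    (use nth_mem[of i "filter (\<lambda>e. src e = u) E"] in \<open>auto simp: creditors_def out_weights_def\<close>)

context
  fixes n :: nat and E :: "edge list"
  assumes edges: "\<And>e. e \<in> set E \<Longrightarrow> src e < n \<and> dst e < n \<and> src e \<noteq> dst e"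
begin

lemma bij_betw_out_stub: "bij_betw (out_stub E) {..<length E} (out_stubs (system_of n ext E))"
  unfolding out_stub_def out_stubs_system_of by (rule bij_betw_rank) (use edges in auto)

lemma bij_betw_in_stub: "bij_betw (in_stub E) {..<length E} (in_stubs (system_of n ext E))"
  unfolding in_stub_def in_stubs_system_of by (rule bij_betw_rank) (use edges in auto)

lemma out_stub_edge:
  assumes "k < length E"
  shows "creditor (network_of n E) (out_stub E k) = dst (E ! k)"
    "liability (system_of n ext E) (out_stub E k) = wt (E ! k)"
  using assms edges[of "E ! k"] nth_filter_rank[of k E "\<lambda>e. src e = src (E ! k)"]
  by (auto simp: creditor_def liability_def out_stub_def creditors_def out_weights_def)

lemma consistent_network_of: "consistent (system_of n ext E) (network_of n E)"
  unfolding consistent_def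
proof
  show "map length (network_of n E) = map (length \<circ> outgoing) (banks (system_of n ext E))"
    by (simp add: network_of_def system_of_def creditors_def out_weights_def)
  let ?S = "system_of n ext E"
  \<comment> \<open>Both kinds of stubs are in bijection with the positions of \<open>E\<close>; the
    matching sends an outgoing stub to the incoming stub of the same edge.\<close>
  let ?m = "in_stub E \<circ> the_inv_into {..<length E} (out_stub E)"
  have bij: "bij_betw ?m (out_stubs ?S) (in_stubs ?S)"
    by (rule bij_betw_trans[OF bij_betw_the_inv_into[OF bij_betw_out_stub] bij_betw_in_stub])
  have match: "case ?m e of (w, j) \<Rightarrow> creditor (network_of n E) e = w \<and>
      incoming (banks ?S ! w) ! j = liability ?S e \<and> fst e \<noteq> w" if "e \<in> out_stubs ?S" for e
  proof -
    from that obtain k where k: "k < length E" "e = out_stub E k"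
      using bij_betw_out_stub[of ext] by (auto simp: bij_betw_def)
    then have "?m e = in_stub E k"
      using bij_betw_out_stub[of ext] by (simp add: the_inv_into_f_f bij_betw_def)
    then show ?thesis
      using k out_stub_edge[OF k(1)] edges[of "E ! k"] nth_filter_rank[of k E "\<lambda>e. dst e = dst (E ! k)"]
      by (auto simp: in_stub_def in_weights_def out_stub_def)
  qed
  show "\<exists>m. bij_betw m (out_stubs ?S) (in_stubs ?S) \<and> (\<forall>e\<in>out_stubs ?S.
      (case m e of (w, j) \<Rightarrow> creditor (network_of n E) e = w \<and>
        incoming (banks ?S ! w) ! j = liability ?S e \<and> fst e \<noteq> w))"
    by (intro exI[of _ ?m] conjI ballI bij match)
qed

section \<open>Clearing states of acyclic networks\<close>

lemma inflow_eq:
  "(\<Sum>e \<in> {e \<in> out_stubs (system_of n ext E). creditor (network_of n E) e = w}.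
      payment (system_of n ext E) e (a ! fst e)) =
   (\<Sum>k<length E. if dst (E ! k) = w
      then payment (system_of n ext E) (out_stub E k) (a ! src (E ! k)) else 0)"
proof -
  let ?S = "system_of n ext E" and ?N = "network_of n E"
  have fin: "finite (out_stubs ?S)" by (simp add: out_stubs_system_of)
  have "(\<Sum>e \<in> {e \<in> out_stubs ?S. creditor ?N e = w}. payment ?S e (a ! fst e)) =
      (\<Sum>e \<in> out_stubs ?S. if creditor ?N e = w then payment ?S e (a ! fst e) else 0)"
    by (simp add: sum.inter_filter[OF fin])
  also have "\<dots> = (\<Sum>k<length E. if creditor ?N (out_stub E k) = w
      then payment ?S (out_stub E k) (a ! fst (out_stub E k)) else 0)"
    using sum.reindex_bij_betw[OF bij_betw_out_stub[of ext],
      of "\<lambda>e. if creditor ?N e = w then payment ?S e (a ! fst e) else 0"] by simp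
  also have "\<dots> = (\<Sum>k<length E. if dst (E ! k) = w
      then payment ?S (out_stub E k) (a ! src (E ! k)) else 0)"
    by (intro sum.cong) (auto simp: out_stub_edge, simp_all add: out_stub_def)
  finally show ?thesis .
qed

text \<open>The stubs served before \<open>i\<close> do not reduce its payment: without assets
  nothing is paid at all, a lone stub comes first, and assets that cover all stubs still cover this
  one after the earlier payments.\<close>

lemma payment_eq_min:
  assumes "(u, i) \<in> out_stubs (system_of n ext E)" "0 \<le> a"
    and "a = 0 \<or> real (sum_list (out_weights E u)) \<le> a \<or> length (out_weights E u) \<le> 1"
  shows "payment (system_of n ext E) (u, i) a = min (real (out_weights E u ! i)) a"
proof -
  let ?l = "\<lambda>j. real (out_weights E u ! j)"
  have u: "u < n" and i: "i < length (out_weights E u)"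
    using assms(1) by (auto simp: out_stubs_def)
  have pay: "payment (system_of n ext E) (u, i) a = min (?l i) (max 0 (a - sum ?l {..<i}))"
    using u by (simp add: payment_def liability_def)
  from assms(3) consider "a = 0" | "i = 0" | "real (sum_list (out_weights E u)) \<le> a"
    using i by fastforce
  then show ?thesis
  proof cases
    case 1
    have "0 \<le> sum ?l {..<i}" by (simp add: sum_nonneg)
    with 1 show ?thesis unfolding pay by (simp add: max_def min_def)
  next
    case 2
    with assms(2) show ?thesis unfolding pay by simp
  next
    case 3
    have "sum ?l {..<i} + ?l i = sum ?l {..<Suc i}" by simp
    also have "\<dots> \<le> sum ?l {..<length (out_weights E u)}"
      using i by (intro sum_mono2) auto
    also have "\<dots> = real (sum_list (out_weights E u))"
      by (simp add: sum_list_sum_nth atLeast0LessThan)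
    finally have "sum ?l {..<i} + ?l i \<le> a" using 3 by linarith
    moreover have "0 \<le> sum ?l {..<i}" by (simp add: sum_nonneg)
    ultimately show ?thesis by (simp add: pay max_def min_def)
  qed
qed

text \<open>On an acyclic network the clearing equations determine the assets level by level.\<close>

lemma clearing_state_acyclic:
  fixes lev :: "nat \<Rightarrow> nat" and V :: "nat \<Rightarrow> real"
  assumes lev: "\<And>e. e \<in> set E \<Longrightarrow> lev (src e) < lev (dst e)"
    and V_nonneg: "\<And>u. u < n \<Longrightarrow> 0 \<le> V u"
    and V_out: "\<And>u. u < n \<Longrightarrow> V u = 0 \<or> real (sum_list (out_weights E u)) \<le> V u \<or>
      length (out_weights E u) \<le> 1"
    and V_eq: "\<And>w. w < n \<Longrightarrow> V w = real (ext w) +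
      (\<Sum>e\<leftarrow>E. if dst e = w then min (real (wt e)) (V (src e)) else 0)"
  shows "clearing_state (system_of n ext E) (network_of n E) = map V [0..<n]"
proof -
  let ?S = "system_of n ext E" and ?N = "network_of n E"
  \<comment> \<open>This is stated for any \<open>a\<close> that agrees with \<open>V\<close> on the
    levels below \<open>w\<close>, so that it verifies that \<open>V\<close> is a solution and also
    drives the induction by which every solution equals \<open>V\<close>.\<close>
  have step: "real (ext w) + (\<Sum>e \<in> {e \<in> out_stubs ?S. creditor ?N e = w}.
      payment ?S e (a ! fst e)) = V w"
    if w: "w < n" and a: "\<And>u. u < n \<Longrightarrow> lev u < lev w \<Longrightarrow> a ! u = V u" for w a
  proof -
    have "payment ?S (out_stub E k) (a ! src (E ! k)) = min (real (wt (E ! k))) (V (src (E ! k)))"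
      if k: "k < length E" "dst (E ! k) = w" for k
    proof -
      have src: "src (E ! k) < n" "lev (src (E ! k)) < lev w"
        using edges[of "E ! k"] lev[of "E ! k"] k by auto
      obtain i where i: "out_stub E k = (src (E ! k), i)" by (simp add: out_stub_def)
      have "(src (E ! k), i) \<in> out_stubs ?S"
        using bij_betwE[OF bij_betw_out_stub[of ext]] k(1) i by force
      moreover have "out_weights E (src (E ! k)) ! i = wt (E ! k)"
        using out_stub_edge(2)[OF k(1), of ext] src(1) i by (simp add: liability_def)
      ultimately show ?thesis
        using payment_eq_min[OF _ V_nonneg[OF src(1)] V_out[OF src(1)]] a[OF src] i by simp
    qed
    then have "(\<Sum>k<length E. if dst (E ! k) = w
        then payment ?S (out_stub E k) (a ! src (E ! k)) else 0) =
      (\<Sum>k<length E. if dst (E ! k) = w then min (real (wt (E ! k))) (V (src (E ! k))) else 0)"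
      by (intro sum.cong) auto
    also have "\<dots> = (\<Sum>e\<leftarrow>E. if dst e = w then min (real (wt e)) (V (src e)) else 0)"
      by (simp add: sum_list_sum_nth atLeast0LessThan)
    finally show ?thesis using V_eq[OF w] by (simp add: inflow_eq)
  qed
  have sol: "clearing_solution ?S ?N (map V [0..<n])"
    unfolding clearing_solution_def by (auto simp: step)
  have unique: "b = map V [0..<n]" if b: "clearing_solution ?S ?N b" for b
  proof -
    have "b ! w = V w" if "w < n" for w
      using that
    proof (induction "lev w" arbitrary: w rule: less_induct)
      case less
      have "b ! w = real (ext w) + (\<Sum>e \<in> {e \<in> out_stubs ?S. creditor ?N e = w}.
          payment ?S e (b ! fst e))"
        using b less.prems by (auto simp: clearing_solution_def)
      also have "\<dots> = V w" using less by (intro step) auto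
      finally show ?case .
    qed
    then show ?thesis
      using b by (intro nth_equalityI) (auto simp: clearing_solution_def)
  qed
  show ?thesis
    unfolding clearing_state_def
  proof (rule the_equality)
    show "clearing_solution ?S ?N (map V [0..<n]) \<and>
        (\<forall>b. clearing_solution ?S ?N b \<longrightarrow> list_all2 (\<le>) b (map V [0..<n]))"
    proof (intro conjI allI impI sol)
      fix b assume "clearing_solution ?S ?N b"
      then have "b = map V [0..<n]" by (rule unique)
      then show "list_all2 (\<le>) b (map V [0..<n])" by (simp add: list_all2_refl)
    qed
  qed (rule unique, erule conjunct1)
qed

end

section \<open>The reduction\<close>

definition bit_length :: "nat \<Rightarrow> nat" where
  "bit_length w = length (list_of (enc_nat w))"

lemma less_two_power_bit_length: "w < 2 ^ bit_length w"
proof (induction w rule: less_induct)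
  case (less w)
  show ?case
  proof (cases "w = 0")
    case False
    then have "bit_length w = Suc (bit_length (w div 2))"
      by (simp add: bit_length_def enc_nat.simps[of w])
    moreover have "w div 2 < 2 ^ bit_length (w div 2)" using False by (intro less.IH) simp
    ultimately show ?thesis by simp
  qed simp
qed

text \<open>The banks 0 to 3 are the target, the source, the bank without assets and the isolated
  bank. As 4 is even, the parity of a literal bank is the sign of the literal, which is how
  \<open>assignment_of\<close> reads it.\<close>

definition lit_bank :: "literal \<Rightarrow> nat" where
  "lit_bank = (\<lambda>(x, b). 4 + 2 * x + of_bool b)"

definition clause_bank :: "cnf \<Rightarrow> nat \<Rightarrow> nat" where
  "clause_bank \<phi> c = 4 + 2 * num_vars \<phi> + c"

definition num_banks :: "cnf \<Rightarrow> nat" where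
  "num_banks \<phi> = 4 + 2 * num_vars \<phi> + length (clauses \<phi>)"

definition occs :: "cnf \<Rightarrow> (literal \<times> nat) list" where
  "occs \<phi> = concat (map (\<lambda>c. map (\<lambda>l. (l, c)) (fst (clauses \<phi> ! c))) [0..<length (clauses \<phi>)])"

text \<open>A sum instead of a maximum of bit lengths: it bounds each of them as well, and it is the
  length of the concatenated binary weights, so that it is available in unary.\<close>

definition weight_bits :: "cnf \<Rightarrow> nat" where
  "weight_bits \<phi> = (\<Sum>(C, w) \<leftarrow> clauses \<phi>. bit_length w)"

definition occ_weight :: "cnf \<Rightarrow> nat \<Rightarrow> nat" where
  "occ_weight \<phi> k = 2 ^ (weight_bits \<phi> + k)"

text \<open>The exponents continue those of \<open>occ_weight\<close>. So no variable weight is an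
  occurrence weight, and each of them exceeds the sum of all occurrence weights.\<close>

definition var_weight :: "cnf \<Rightarrow> nat \<Rightarrow> nat" where
  "var_weight \<phi> x = 2 ^ (weight_bits \<phi> + length (occs \<phi>) + x)"

text \<open>Bank \<open>1\<close> can pay all its stubs and bank \<open>2\<close> has no assets, so the bank of the literal
  \<open>(x, b)\<close> receives \<open>var_weight \<phi> x\<close> or nothing.  Bank \<open>3\<close> is isolated: it serves to make the bank
  numbers of the literals of \<open>x\<close> differ just in the last bit.\<close>

definition var_edges :: "cnf \<Rightarrow> bool list \<Rightarrow> edge list" where
  "var_edges \<phi> \<alpha> =
     map (\<lambda>x. (1, lit_bank (x, \<alpha> ! x), var_weight \<phi> x)) [0..<num_vars \<phi>] @
     map (\<lambda>x. (2, lit_bank (x, \<not> \<alpha> ! x), var_weight \<phi> x)) [0..<num_vars \<phi>]"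

definition occ_edges :: "cnf \<Rightarrow> edge list" where
  "occ_edges \<phi> = map (\<lambda>k. (lit_bank (fst (occs \<phi> ! k)), clause_bank \<phi> (snd (occs \<phi> ! k)),
     occ_weight \<phi> k)) [0..<length (occs \<phi>)]"

definition clause_edges :: "cnf \<Rightarrow> edge list" where
  "clause_edges \<phi> = map (\<lambda>c. (clause_bank \<phi> c, 0, snd (clauses \<phi> ! c))) [0..<length (clauses \<phi>)]"

definition edges :: "cnf \<Rightarrow> bool list \<Rightarrow> edge list" where
  "edges \<phi> \<alpha> = var_edges \<phi> \<alpha> @ occ_edges \<phi> @ clause_edges \<phi>"

text \<open>This power of two exceeds the sum of all variable weights, whose exponents end just
  below it.\<close>

definition externals :: "cnf \<Rightarrow> nat \<Rightarrow> nat" where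
  "externals \<phi> u = (if u = 1 then 2 ^ (weight_bits \<phi> + length (occs \<phi>) + num_vars \<phi>) else 0)"

text \<open>The stubs are the same for all assignments (\<open>reduced_instance_eq\<close>). The
  all-false one is convenient because its encoding is a list of leaves.\<close>

definition reduced_instance :: "cnf \<Rightarrow> stub_system" where
  "reduced_instance \<phi> =
     system_of (num_banks \<phi>) (externals \<phi>) (edges \<phi> (replicate (num_vars \<phi>) False))"

definition reduced_network :: "cnf \<Rightarrow> bool list \<Rightarrow> network" where
  "reduced_network \<phi> \<alpha> = network_of (num_banks \<phi>) (edges \<phi> \<alpha>)"

definition assignment_of :: "network \<Rightarrow> bool list" where
  "assignment_of N = map odd (N ! 1)"

lemma lit_bank_simps [simp]:
  "lit_bank (x, b) \<noteq> 0" "lit_bank (x, b) \<noteq> Suc 0" "lit_bank (x, b) \<noteq> 2" "lit_bank (x, b) \<noteq> 3"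
  "odd (lit_bank (x, b)) \<longleftrightarrow> b" "lit_bank (x, b) = lit_bank (y, c) \<longleftrightarrow> x = y \<and> b = c"
proof -
  show "lit_bank (x, b) = lit_bank (y, c) \<longleftrightarrow> x = y \<and> b = c"
    unfolding lit_bank_def by (cases b; cases c; simp; presburger)
qed (auto simp: lit_bank_def)

declare lit_bank_simps(1-4) [THEN not_sym, simp]

lemma lit_bank_neq_clause_bank: "x < num_vars \<phi> \<Longrightarrow> lit_bank (x, b) \<noteq> clause_bank \<phi> c"
  by (cases b) (auto simp: lit_bank_def clause_bank_def)

lemma filter_upt_unique:
  "x < n \<Longrightarrow> (\<And>y. y < n \<Longrightarrow> P y \<longleftrightarrow> y = x) \<Longrightarrow> filter P [0..<n] = [x]"
proof (induction n)
  case (Suc n)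
  show ?case
  proof (cases "x = n")
    case True
    then have "filter P [0..<n] = []" using Suc.prems(2) by (auto simp: filter_empty_conv)
    with True Suc.prems(2)[of n] show ?thesis by simp
  next
    case False
    with Suc show ?thesis by auto
  qed
qed simp

lemma sum_two_powers: "(\<Sum>k\<leftarrow>[0..<n]. 2 ^ (b + k)) < (2 ^ (b + n) :: nat)"
  by (induction n) auto

context
  fixes \<phi> :: cnf
  assumes valid: "\<phi> \<in> instances max_2_sat"
begin

section \<open>Edges of equal weight\<close>

lemma clause_valid:
  assumes "c < length (clauses \<phi>)"
  shows "(x, b) \<in> set (fst (clauses \<phi> ! c)) \<Longrightarrow> x < num_vars \<phi>" "0 < snd (clauses \<phi> ! c)"
  using valid nth_mem[OF assms] by (fastforce simp: max_2_sat_def)+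

lemma mem_occs:
  "((x, b), c) \<in> set (occs \<phi>) \<longleftrightarrow> c < length (clauses \<phi>) \<and> (x, b) \<in> set (fst (clauses \<phi> ! c))"
  by (auto simp: occs_def)

lemma clause_weight_less:
  assumes "c < length (clauses \<phi>)"
  shows "snd (clauses \<phi> ! c) < 2 ^ weight_bits \<phi>"
proof -
  have "bit_length (snd (clauses \<phi> ! c)) \<le> weight_bits \<phi>"
    unfolding weight_bits_def using nth_mem[OF assms]
    by (intro member_le_sum_list) (auto simp: case_prod_unfold intro: rev_image_eqI)
  then have "(2::nat) ^ bit_length (snd (clauses \<phi> ! c)) \<le> 2 ^ weight_bits \<phi>"
    by (intro power_increasing) auto
  with less_two_power_bit_length show ?thesis by (rule less_le_trans)
qed

lemma edgesE:
  assumes "e \<in> set (edges \<phi> \<alpha>)"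
  obtains (source) x where "x < num_vars \<phi>" "e = (1, lit_bank (x, \<alpha> ! x), var_weight \<phi> x)"
  | (zero) x where "x < num_vars \<phi>" "e = (2, lit_bank (x, \<not> \<alpha> ! x), var_weight \<phi> x)"
  | (occ) k x b c where "k < length (occs \<phi>)" "occs \<phi> ! k = ((x, b), c)" "x < num_vars \<phi>"
      "c < length (clauses \<phi>)" "e = (lit_bank (x, b), clause_bank \<phi> c, occ_weight \<phi> k)"
  | (clause) c where "c < length (clauses \<phi>)" "e = (clause_bank \<phi> c, 0, snd (clauses \<phi> ! c))"
proof -
  from assms consider "e \<in> set (var_edges \<phi> \<alpha>)" | "e \<in> set (occ_edges \<phi>)" | "e \<in> set (clause_edges \<phi>)"
    by (auto simp: edges_def)
  then show thesis
  proof cases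
    case 2
    then obtain k where k: "k < length (occs \<phi>)" "e = (lit_bank (fst (occs \<phi> ! k)),
        clause_bank \<phi> (snd (occs \<phi> ! k)), occ_weight \<phi> k)" by (auto simp: occ_edges_def)
    obtain x b c where o: "occs \<phi> ! k = ((x, b), c)" by (metis prod.collapse)
    with nth_mem[OF k(1)] have "c < length (clauses \<phi>)" "(x, b) \<in> set (fst (clauses \<phi> ! c))"
      by (simp_all add: mem_occs)
    with clause_valid(1) have "x < num_vars \<phi>" by blast
    with k o \<open>c < length (clauses \<phi>)\<close> show thesis by (intro occ[of k x b c]) auto
  qed (auto simp: var_edges_def clause_edges_def intro: source zero clause)
qed

lemma edges_bounds:
  assumes "e \<in> set (edges \<phi> \<alpha>)"
  shows "src e < num_banks \<phi> \<and> dst e < num_banks \<phi> \<and> src e \<noteq> dst e"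
  using assms by (cases rule: edgesE) (auto simp: num_banks_def lit_bank_def clause_bank_def)

lemma wt_pos: "e \<in> set (edges \<phi> \<alpha>) \<Longrightarrow> 0 < wt e"
  by (erule edgesE) (auto simp: var_weight_def occ_weight_def intro: clause_valid)

text \<open>Clause weights are smaller than all powers of two in use, occurrences and variables have
  disjoint ranges of exponents, and within a range the exponent determines the occurrence or the
  variable. Clause weights may coincide with each other, but then both edges end at the
  target.\<close>

lemma same_weight_edges:
  assumes "e \<in> set (edges \<phi> \<alpha>)" "e' \<in> set (edges \<phi> \<beta>)" "wt e = wt e'"
  obtains (var) x where "x < num_vars \<phi>" "wt e = var_weight \<phi> x"
      "e \<in> {(1, lit_bank (x, \<alpha> ! x), var_weight \<phi> x), (2, lit_bank (x, \<not> \<alpha> ! x), var_weight \<phi> x)}"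
      "e' \<in> {(1, lit_bank (x, \<beta> ! x), var_weight \<phi> x), (2, lit_bank (x, \<not> \<beta> ! x), var_weight \<phi> x)}"
  | (occ) "e = e'"
  | (clause) "dst e = 0" "dst e' = 0"
proof -
  have clause: "snd (clauses \<phi> ! c) \<noteq> 2 ^ (weight_bits \<phi> + i)" if "c < length (clauses \<phi>)" for c i
  proof -
    have "snd (clauses \<phi> ! c) < 2 ^ weight_bits \<phi>" using that by (rule clause_weight_less)
    also have "\<dots> \<le> 2 ^ (weight_bits \<phi> + i)" by (intro power_increasing) auto
    finally show ?thesis by simp
  qed
  note clause' = clause[symmetric]
  from assms(1) show thesis
  proof (cases rule: edgesE)
    case (source x)
    from assms(2) show thesis
      by (cases rule: edgesE)
        (use source assms(3) clause'[of _ "length (occs \<phi>) + x"] in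
          \<open>auto simp: var_weight_def occ_weight_def add.assoc intro!: var[of x]\<close>)
  next
    case (zero x)
    from assms(2) show thesis
      by (cases rule: edgesE)
        (use zero assms(3) clause'[of _ "length (occs \<phi>) + x"] in
          \<open>auto simp: var_weight_def occ_weight_def add.assoc intro!: var[of x]\<close>)
  next
    case (occ k)
    from assms(2) show thesis
      by (cases rule: edgesE)
        (use occ assms(3) clause'[of _ k] in
          \<open>auto simp: var_weight_def occ_weight_def add.assoc intro!: that(2)\<close>)
  next
    case c: (clause c)
    from assms(2) show thesis
    proof (cases rule: edgesE)
      case (clause c')
      with c show thesis by (intro that(3)) auto
    qed (use c assms(3) clause in \<open>auto simp: var_weight_def occ_weight_def add.assoc\<close>)
  qed
qed

section \<open>The stubs do not depend on the assignment\<close>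

lemma filter_src_edges:
  "filter (\<lambda>e. src e = 1) (edges \<phi> \<alpha>) =
    map (\<lambda>x. (1, lit_bank (x, \<alpha> ! x), var_weight \<phi> x)) [0..<num_vars \<phi>]"
  "filter (\<lambda>e. src e = 2) (edges \<phi> \<alpha>) =
    map (\<lambda>x. (2, lit_bank (x, \<not> \<alpha> ! x), var_weight \<phi> x)) [0..<num_vars \<phi>]"
  "u \<noteq> 1 \<Longrightarrow> u \<noteq> 2 \<Longrightarrow> filter (\<lambda>e. src e = u) (edges \<phi> \<alpha>) =
    filter (\<lambda>e. src e = u) (occ_edges \<phi> @ clause_edges \<phi>)"
  by (auto simp: edges_def var_edges_def occ_edges_def clause_edges_def filter_empty_conv filter_map
      comp_def lit_bank_def clause_bank_def case_prod_unfold)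

lemma creditors_edges:
  "creditors (edges \<phi> \<alpha>) 1 = map (\<lambda>x. lit_bank (x, \<alpha> ! x)) [0..<num_vars \<phi>]"
  "creditors (edges \<phi> \<alpha>) 2 = map (\<lambda>x. lit_bank (x, \<not> \<alpha> ! x)) [0..<num_vars \<phi>]"
  "u \<noteq> 1 \<Longrightarrow> u \<noteq> 2 \<Longrightarrow> creditors (edges \<phi> \<alpha>) u = creditors (edges \<phi> \<beta>) u"
  by (simp_all add: creditors_def filter_src_edges filter_src_edges(1)[unfolded One_nat_def] comp_def)

lemma out_weights_edges:
  "out_weights (edges \<phi> \<alpha>) 1 = map (var_weight \<phi>) [0..<num_vars \<phi>]"
  "out_weights (edges \<phi> \<alpha>) 2 = map (var_weight \<phi>) [0..<num_vars \<phi>]"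
  by (simp_all add: out_weights_def filter_src_edges filter_src_edges(1)[unfolded One_nat_def] comp_def)

lemma out_weights_edges_indep: "out_weights (edges \<phi> \<alpha>) u = out_weights (edges \<phi> \<beta>) u"
proof -
  consider "u = 1" | "u = 2" | "u \<noteq> 1" "u \<noteq> 2" by blast
  then show ?thesis
    by cases (simp_all only: out_weights_edges, simp add: out_weights_def filter_src_edges)
qed

text \<open>Under every assignment a literal bank of \<open>x\<close> is the creditor of exactly one
  edge of weight \<open>var_weight \<phi> x\<close>: bank 1 is the debtor if the literal is true,
  and bank 2 otherwise. This is why \<alpha> is absent on the right.\<close>

lemma in_weights_var_edges:
  "in_weights (var_edges \<phi> \<alpha>) u =
    map (var_weight \<phi>) (filter (\<lambda>x. u = lit_bank (x, False) \<or> u = lit_bank (x, True)) [0..<num_vars \<phi>])"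
proof (cases "\<exists>x<num_vars \<phi>. \<exists>b. u = lit_bank (x, b)")
  case True
  then obtain x b where x: "x < num_vars \<phi>" and u: "u = lit_bank (x, b)" by blast
  have "filter (\<lambda>y. u = lit_bank (y, False) \<or> u = lit_bank (y, True)) [0..<num_vars \<phi>] = [x]"
    by (rule filter_upt_unique[OF x]) (cases b; auto simp: u)
  moreover have "filter (\<lambda>y. lit_bank (y, \<alpha> ! y) = u) [0..<num_vars \<phi>] = (if \<alpha> ! x = b then [x] else [])"
    using x by (auto simp: u filter_empty_conv intro!: filter_upt_unique)
  moreover have "filter (\<lambda>y. lit_bank (y, \<not> \<alpha> ! y) = u) [0..<num_vars \<phi>] = (if \<alpha> ! x = b then [] else [x])"
    using x by (auto simp: u filter_empty_conv intro!: filter_upt_unique)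
  ultimately show ?thesis
    by (simp add: in_weights_def var_edges_def filter_map comp_def)
next
  case False
  then show ?thesis
    by (auto simp: in_weights_def var_edges_def filter_map comp_def filter_empty_conv)
qed

lemma in_weights_append: "in_weights (E @ F) u = in_weights E u @ in_weights F u"
  by (simp add: in_weights_def)

lemma in_weights_edges_indep: "in_weights (edges \<phi> \<alpha>) u = in_weights (edges \<phi> \<beta>) u"
  by (simp add: edges_def in_weights_append in_weights_var_edges)

text \<open>Having a single incoming stub is what prevents banks 1 and 2 from paying the same
  literal of \<open>x\<close>.\<close>

lemma in_weights_lit_bank:
  assumes "x < num_vars \<phi>"
  shows "in_weights (edges \<phi> \<alpha>) (lit_bank (x, b)) = [var_weight \<phi> x]"
proof -
  have "filter (\<lambda>y. lit_bank (x, b) = lit_bank (y, False) \<or> lit_bank (x, b) = lit_bank (y, True))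
      [0..<num_vars \<phi>] = [x]"
    by (rule filter_upt_unique[OF assms]) (cases b; auto)
  moreover have "in_weights (occ_edges \<phi>) (lit_bank (x, b)) = []"
    "in_weights (clause_edges \<phi>) (lit_bank (x, b)) = []"
    using assms by (auto simp: in_weights_def occ_edges_def clause_edges_def filter_map comp_def
        filter_empty_conv lit_bank_def clause_bank_def)
  ultimately show ?thesis
    by (simp add: edges_def in_weights_append in_weights_var_edges)
qed

lemma reduced_instance_eq:
  "reduced_instance \<phi> = system_of (num_banks \<phi>) (externals \<phi>) (edges \<phi> \<alpha>)"
  unfolding reduced_instance_def system_of_def
  using out_weights_edges_indep in_weights_edges_indep by metis

section \<open>Consistent networks and assignments\<close>

lemma consistent_reduced_network: "consistent (reduced_instance \<phi>) (reduced_network \<phi> \<alpha>)"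
  unfolding reduced_instance_eq[of \<alpha>] reduced_network_def
  by (rule consistent_network_of[OF edges_bounds])

lemma num_banks_gt: "u < 4 \<Longrightarrow> u < num_banks \<phi>"
  by (simp add: num_banks_def)

lemma nth_reduced_network: "u < num_banks \<phi> \<Longrightarrow> reduced_network \<phi> \<alpha> ! u = creditors (edges \<phi> \<alpha>) u"
  by (simp add: reduced_network_def)

lemma assignment_of_reduced_network:
  "length \<alpha> = num_vars \<phi> \<Longrightarrow> assignment_of (reduced_network \<phi> \<alpha>) = \<alpha>"
  by (simp add: assignment_of_def nth_reduced_network num_banks_gt creditors_edges(1)[simplified]
      list_eq_iff_nth_eq)

lemma reduced_instance_valid: "reduced_instance \<phi> \<in> instances max_assets"
proof -
  let ?\<alpha> = "replicate (num_vars \<phi>) False"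
  have "0 < l" if "l \<in> set (out_weights (edges \<phi> ?\<alpha>) u) \<union> set (in_weights (edges \<phi> ?\<alpha>) u)" for l u
    using that by (auto simp: out_weights_def in_weights_def dest: wt_pos[of _ ?\<alpha>])
  then have "\<forall>B \<in> set (banks (reduced_instance \<phi>)). \<forall>l \<in> set (outgoing B) \<union> set (incoming B). 0 < l"
    unfolding reduced_instance_def by (auto simp: system_of_def)
  moreover have "target (reduced_instance \<phi>) < length (banks (reduced_instance \<phi>))"
    by (simp add: reduced_instance_def num_banks_gt)
  ultimately show ?thesis
    using consistent_reduced_network by (auto simp: max_assets_def)
qed

text \<open>An outgoing stub can only end at a bank with an incoming stub of the same weight. By
  \<open>same_weight_edges\<close> this determines the creditor, except for the stubs of weight
  \<open>var_weight \<phi> x\<close> at banks 1 and 2, which have the two literals of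
  \<open>x\<close> to share.\<close>

lemma consistent_eq:
  assumes "consistent (reduced_instance \<phi>) N"
  shows "length (assignment_of N) = num_vars \<phi>" "N = reduced_network \<phi> (assignment_of N)"
proof -
  \<comment> \<open>Since the stubs are the same for every assignment, they may be presented with
    the assignment that is read off from \<open>N\<close> itself, even before its length is
    known.\<close>
  define \<alpha> where "\<alpha> = assignment_of N"
  let ?E = "edges \<phi> \<alpha>"
  let ?S = "system_of (num_banks \<phi>) (externals \<phi>) ?E"
  from assms have cons: "consistent ?S N" by (simp add: reduced_instance_eq[of \<alpha>])
  then have "map length N = map (length \<circ> outgoing) (banks ?S)"
    by (simp add: consistent_def)
  then have lenN: "length N = num_banks \<phi>"
    and len: "\<And>u. u < num_banks \<phi> \<Longrightarrow> length (N ! u) = length (out_weights ?E u)"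
    by (auto simp: list_eq_iff_nth_eq)
  show len\<alpha>: "length (assignment_of N) = num_vars \<phi>"
    using len[of 1] out_weights_edges(1) by (simp add: assignment_of_def num_banks_gt)
  obtain m where m': "bij_betw m (out_stubs ?S) (in_stubs ?S) \<and> (\<forall>e\<in>out_stubs ?S.
      case m e of (w, j) \<Rightarrow> creditor N e = w \<and> incoming (banks ?S ! w) ! j = liability ?S e \<and> fst e \<noteq> w)"
    using cons[unfolded consistent_def, THEN conjunct2] ..
  note m = m'[THEN conjunct1] m'[THEN conjunct2, THEN bspec]
  have stub: "\<exists>j. m (u, i) = (N ! u ! i, j) \<and> j < length (in_weights ?E (N ! u ! i)) \<and>
      N ! u ! i < num_banks \<phi> \<and> in_weights ?E (N ! u ! i) ! j = out_weights ?E u ! i"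
    if "u < num_banks \<phi>" "i < length (out_weights ?E u)" for u i
  proof -
    have mem: "(u, i) \<in> out_stubs ?S" using that by (simp add: out_stubs_def)
    obtain w j where wj: "m (u, i) = (w, j)" by fastforce
    have "(w, j) \<in> in_stubs ?S" using bij_betwE[OF m(1)] mem wj by force
    moreover have "w = N ! u ! i" "incoming (banks ?S ! w) ! j = out_weights ?E u ! i"
      using m(2)[OF mem] wj that by (auto simp: creditor_def liability_def)
    ultimately show ?thesis using wj by (auto simp: in_stubs_def)
  qed
  have edge: "\<exists>e\<in>set ?E. dst e = N ! u ! i \<and> wt e = out_weights ?E u ! i"
    if "u < num_banks \<phi>" "i < length (out_weights ?E u)" for u i
  proof -
    have "out_weights ?E u ! i \<in> set (in_weights ?E (N ! u ! i))"
      using stub[OF that] by (metis nth_mem)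
    then show ?thesis by (auto simp: in_weights_def)
  qed
  have var: "\<exists>b. N ! u ! x = lit_bank (x, b)" if "u = 1 \<or> u = 2" "x < num_vars \<phi>" for u x
  proof -
    have w: "out_weights ?E u = map (var_weight \<phi>) [0..<num_vars \<phi>]"
      using that(1) out_weights_edges by blast
    then have x: "u < num_banks \<phi>" "x < length (out_weights ?E u)" using that by (auto simp: num_banks_gt)
    have "(1, lit_bank (x, \<alpha> ! x), var_weight \<phi> x) \<in> set ?E"
      using that(2) by (auto simp: edges_def var_edges_def)
    moreover obtain e where e: "e \<in> set ?E" "dst e = N ! u ! x" "wt e = out_weights ?E u ! x"
      using edge[OF x] by blast
    note e(1)
    moreover have "wt (1, lit_bank (x, \<alpha> ! x), var_weight \<phi> x) = wt e" using e(3) w that(2) by simp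
    ultimately show ?thesis
      by (rule same_weight_edges[of _ \<alpha> e \<alpha>]) (use e(2)[symmetric] in \<open>auto simp: var_weight_def\<close>)
  qed
  have one: "N ! 1 ! x = lit_bank (x, \<alpha> ! x)" if x: "x < num_vars \<phi>" for x
  proof -
    obtain b where b: "N ! 1 ! x = lit_bank (x, b)" using var[of 1 x] x by auto
    have "\<alpha> ! x = odd (N ! 1 ! x)"
      using x len\<alpha> by (simp add: \<alpha>_def assignment_of_def)
    with b show ?thesis by simp
  qed
  have two: "N ! 2 ! x = lit_bank (x, \<not> \<alpha> ! x)" if x: "x < num_vars \<phi>" for x
  proof -
    obtain b where b: "N ! 2 ! x = lit_bank (x, b)" using var[of 2 x] x by auto
    have "b \<noteq> \<alpha> ! x"
    proof
      assume "b = \<alpha> ! x"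
      then have same: "N ! 2 ! x = N ! 1 ! x" using b one[OF x] by simp
      have l: "x < length (out_weights ?E 1)" "x < length (out_weights ?E 2)"
        using x out_weights_edges by simp_all
      obtain j1 where j1: "m (1, x) = (N ! 1 ! x, j1)" "j1 < length (in_weights ?E (N ! 1 ! x))"
        using stub[OF _ l(1)] num_banks_gt[of 1] by auto
      obtain j2 where j2: "m (2, x) = (N ! 2 ! x, j2)" "j2 < length (in_weights ?E (N ! 2 ! x))"
        using stub[OF _ l(2)] num_banks_gt[of 2] by auto
      \<comment> \<open>The literal bank has only the incoming stub 0, so \<open>m\<close> would map
        two different outgoing stubs to it.\<close>
      have "j1 = 0" "j2 = 0"
        using j1(2) j2(2) unfolding same one[OF x] by (simp_all add: in_weights_lit_bank[OF x])
      then have "m (1, x) = m (2, x)" using j1(1) j2(1) same by simp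
      moreover have "(1, x) \<in> out_stubs ?S" "(2, x) \<in> out_stubs ?S"
        using l by (simp_all add: out_stubs_def num_banks_gt)
      ultimately show False
        using bij_betw_imp_inj_on[OF m(1)] by (auto dest: inj_onD)
    qed
    with b show ?thesis by auto
  qed
  have "N ! u = creditors ?E u" if u: "u < num_banks \<phi>" for u
  proof -
    consider "u = 1" | "u = 2" | "u \<noteq> 1" "u \<noteq> 2" by blast
    then show ?thesis
    proof cases
      case 1
      with one len[OF u] show ?thesis
        using creditors_edges(1)[of \<alpha>] out_weights_edges(1)[of \<alpha>] by (auto simp: list_eq_iff_nth_eq)
    next
      case 2
      with two len[OF u] show ?thesis
        using creditors_edges(2)[of \<alpha>] out_weights_edges(2)[of \<alpha>] by (auto simp: list_eq_iff_nth_eq)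
    next
      case 3
      show ?thesis
      proof (rule nth_equalityI)
        show "length (N ! u) = length (creditors ?E u)"
          using len[OF u] by (simp add: creditors_def out_weights_def)
        fix i assume "i < length (N ! u)"
        then have i: "i < length (out_weights ?E u)" using len[OF u] by simp
        obtain e where e: "e \<in> set ?E" "dst e = N ! u ! i" "wt e = out_weights ?E u ! i"
          using edge[OF u i] by blast
        obtain e' where e': "e' \<in> set ?E" "src e' = u" "creditors ?E u ! i = dst e'"
            "out_weights ?E u ! i = wt e'"
          using nth_creditors[of i u ?E] i by (auto simp: out_weights_def)
        from e(3) e'(4) have "wt e' = wt e" by simp
        with e'(1) e(1) show "N ! u ! i = creditors ?E u ! i"
          by (rule same_weight_edges) (use 3 e e' in auto)
      qed
    qed
  qed
  then show "N = reduced_network \<phi> (assignment_of N)"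
    unfolding \<alpha>_def[symmetric]
    by (intro nth_equalityI) (simp_all add: lenN nth_reduced_network, simp add: reduced_network_def)
qed

section \<open>Swaps and flips\<close>

lemma flip_swaps:
  assumes len: "length \<alpha> = num_vars \<phi>" and x: "x < num_vars \<phi>"
  shows "reduced_network \<phi> (\<alpha>[x := \<not> \<alpha> ! x]) \<in> swaps (reduced_instance \<phi>) (reduced_network \<phi> \<alpha>)"
proof -
  let ?N = "reduced_network \<phi> \<alpha>" and ?N' = "reduced_network \<phi> (\<alpha>[x := \<not> \<alpha> ! x])"
  let ?S = "reduced_instance \<phi>"
  have N: "?N ! 1 = map (\<lambda>x. lit_bank (x, \<alpha> ! x)) [0..<num_vars \<phi>]"
    "?N ! 2 = map (\<lambda>x. lit_bank (x, \<not> \<alpha> ! x)) [0..<num_vars \<phi>]"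
    using creditors_edges(1,2) nth_reduced_network num_banks_gt by simp_all
  \<comment> \<open>Banks 1 and 2 list the variables in the same order, so the two stubs of variable
    \<open>x\<close> both have index \<open>x\<close>, and exchanging their creditors is the flip of
    \<open>x\<close>.\<close>
  have eq: "?N' = ?N[1 := (?N ! 1)[x := lit_bank (x, \<not> \<alpha> ! x)], 2 := (?N ! 2)[x := lit_bank (x, \<alpha> ! x)]]"
    (is "_ = ?R")
  proof (rule nth_equalityI)
    show "length ?N' = length ?R" by (simp add: reduced_network_def)
    fix u assume "u < length ?N'"
    then have u: "u < num_banks \<phi>" by (simp add: reduced_network_def)
    have l: "length ?N = num_banks \<phi>" by (simp add: reduced_network_def)
    consider "u = 1" | "u = 2" | "u \<noteq> 1" "u \<noteq> 2" by blast
    then show "?N' ! u = ?R ! u"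
    proof cases
      case 1
      then have "?N' ! u = map (\<lambda>y. lit_bank (y, \<alpha>[x := \<not> \<alpha> ! x] ! y)) [0..<num_vars \<phi>]"
        using creditors_edges(1) nth_reduced_network[OF u] by simp
      also have "\<dots> = (?N ! 1)[x := lit_bank (x, \<not> \<alpha> ! x)]"
        unfolding N using len x by (intro nth_equalityI) (auto simp: nth_list_update)
      finally show ?thesis using 1 u l by simp
    next
      case 2
      then have "?N' ! u = map (\<lambda>y. lit_bank (y, \<not> \<alpha>[x := \<not> \<alpha> ! x] ! y)) [0..<num_vars \<phi>]"
        using creditors_edges(2) nth_reduced_network[OF u] by simp
      also have "\<dots> = (?N ! 2)[x := lit_bank (x, \<alpha> ! x)]"
        unfolding N using len x by (intro nth_equalityI) (auto simp: nth_list_update)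
      finally show ?thesis using 2 u l by simp
    next
      case 3
      then show ?thesis
        using creditors_edges(3)[of u] nth_reduced_network[OF u] by simp
    qed
  qed
  have stubs: "(1, x) \<in> out_stubs ?S" "(2, x) \<in> out_stubs ?S"
    "liability ?S (1, x) = liability ?S (2, x)"
    using x out_weights_edges[of \<alpha>] num_banks_gt
    by (simp_all add: reduced_instance_eq[of \<alpha>] out_stubs_def liability_def)
  have cred: "lit_bank (x, \<alpha> ! x) = creditor ?N (1, x)" "lit_bank (x, \<not> \<alpha> ! x) = creditor ?N (2, x)"
    using x N by (simp_all add: creditor_def)
  have "distinct [1, lit_bank (x, \<alpha> ! x), 2, lit_bank (x, \<not> \<alpha> ! x)]"
    by simp
  with eq stubs cred show ?thesis
    unfolding swaps_def mem_Collect_eq by blast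
qed

text \<open>The endpoints of a swap are pairwise distinct. This excludes swapping an edge with
  itself and swapping two edges into the target, and leaves only the two edges of a common
  variable.\<close>

lemma swaps_flip:
  assumes len: "length \<alpha> = num_vars \<phi>"
    and N': "N' \<in> swaps (reduced_instance \<phi>) (reduced_network \<phi> \<alpha>)"
  obtains x where "x < num_vars \<phi>" "assignment_of N' = \<alpha>[x := \<not> \<alpha> ! x]"
proof -
  let ?N = "reduced_network \<phi> \<alpha>" and ?E = "edges \<phi> \<alpha>"
  let ?S = "system_of (num_banks \<phi>) (externals \<phi>) ?E"
  obtain u1 i1 v1 u2 i2 v2 where N'_eq: "N' = ?N[u1 := (?N ! u1)[i1 := v2], u2 := (?N ! u2)[i2 := v1]]"
    and stubs: "(u1, i1) \<in> out_stubs ?S" "(u2, i2) \<in> out_stubs ?S"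
    and v: "v1 = creditor ?N (u1, i1)" "v2 = creditor ?N (u2, i2)"
    and liab: "liability ?S (u1, i1) = liability ?S (u2, i2)"
    and dist: "distinct [u1, v1, u2, v2]"
    using N' unfolding swaps_def reduced_instance_eq[of \<alpha>] mem_Collect_eq
    by (elim exE conjE) (rule that; assumption)
  have bounds: "u1 < num_banks \<phi>" "u2 < num_banks \<phi>" "i1 < length (out_weights ?E u1)"
    "i2 < length (out_weights ?E u2)"
    using stubs by (auto simp: out_stubs_def)
  have v': "v1 = creditors ?E u1 ! i1" "v2 = creditors ?E u2 ! i2"
    using v bounds by (simp_all add: creditor_def nth_reduced_network)
  have l: "out_weights ?E u1 ! i1 = out_weights ?E u2 ! i2"
    using liab bounds by (simp add: liability_def)
  obtain e1 where e1: "e1 \<in> set ?E" "src e1 = u1" "dst e1 = v1" "wt e1 = out_weights ?E u1 ! i1"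
    using nth_creditors[of i1 u1 ?E] bounds(3) v'(1) by (auto simp: out_weights_def)
  obtain e2 where e2: "e2 \<in> set ?E" "src e2 = u2" "dst e2 = v2" "wt e2 = out_weights ?E u2 ! i2"
    using nth_creditors[of i2 u2 ?E] bounds(4) v'(2) by (auto simp: out_weights_def)
  have "wt e1 = wt e2" using l e1(4) e2(4) by simp
  with e1(1) e2(1) show thesis
  proof (cases rule: same_weight_edges)
    case (var x)
    have ws: "out_weights ?E u1 = map (var_weight \<phi>) [0..<num_vars \<phi>]"
      "out_weights ?E u2 = map (var_weight \<phi>) [0..<num_vars \<phi>]"
      using var(3,4) e1(2) e2(2) out_weights_edges[of \<alpha>] by auto
    have "out_weights ?E u1 ! i1 = var_weight \<phi> x" "out_weights ?E u2 ! i2 = var_weight \<phi> x"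
      using var(2) \<open>wt e1 = wt e2\<close> e1(4) e2(4) by simp_all
    then have i: "i1 = x" "i2 = x"
      using ws bounds(3,4) by (simp_all add: var_weight_def)
    have "N' ! 1 = (?N ! 1)[x := lit_bank (x, \<not> \<alpha> ! x)]"
    proof -
      \<comment> \<open>The swap may name its two edges in either order. Only bank 1 matters for
        \<open>assignment_of\<close>, and in both cases it obtains the former creditor of bank
        2.\<close>
      have "u1 = 1 \<and> u2 = 2 \<and> v2 = lit_bank (x, \<not> \<alpha> ! x) \<or> u1 = 2 \<and> u2 = 1 \<and> v1 = lit_bank (x, \<not> \<alpha> ! x)"
        using var(3,4) e1(2,3) e2(2,3) dist by auto
      moreover have "length ?N = num_banks \<phi>" by (simp add: reduced_network_def)
      ultimately show ?thesis
        unfolding N'_eq i using bounds(1,2) by auto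
    qed
    moreover have "?N ! 1 = map (\<lambda>x. lit_bank (x, \<alpha> ! x)) [0..<num_vars \<phi>]"
      using creditors_edges(1) nth_reduced_network num_banks_gt by simp
    ultimately have "assignment_of N' = \<alpha>[x := \<not> \<alpha> ! x]"
      using len var(1) unfolding assignment_of_def
      by (intro nth_equalityI) (auto simp: nth_list_update)
    with var(1) show thesis by (rule that)
  qed (use e1 e2 dist in auto)
qed

section \<open>Assets of the banks\<close>

lemma satisfies_occs:
  assumes "c < length (clauses \<phi>)"
  shows "satisfies \<alpha> (fst (clauses \<phi> ! c)) \<longleftrightarrow>
    (\<exists>k<length (occs \<phi>). snd (occs \<phi> ! k) = c \<and> \<alpha> ! fst (fst (occs \<phi> ! k)) = snd (fst (occs \<phi> ! k)))"
proof -
  have "satisfies \<alpha> (fst (clauses \<phi> ! c)) \<longleftrightarrow>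
      (\<exists>x b. (x, b) \<in> set (fst (clauses \<phi> ! c)) \<and> \<alpha> ! x = b)"
    unfolding satisfies_def by auto
  also have "\<dots> \<longleftrightarrow> (\<exists>x b. ((x, b), c) \<in> set (occs \<phi>) \<and> \<alpha> ! x = b)"
    using assms by (simp add: mem_occs)
  also have "\<dots> \<longleftrightarrow> (\<exists>p\<in>set (occs \<phi>). snd p = c \<and> \<alpha> ! fst (fst p) = snd (fst p))"
    unfolding Bex_def split_paired_Ex by auto
  finally have "satisfies \<alpha> (fst (clauses \<phi> ! c)) \<longleftrightarrow>
      (\<exists>p\<in>set (occs \<phi>). snd p = c \<and> \<alpha> ! fst (fst p) = snd (fst p))" .
  moreover have "(\<exists>p\<in>set (occs \<phi>). P p) \<longleftrightarrow> (\<exists>k<length (occs \<phi>). P (occs \<phi> ! k))" for P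
    by (metis in_set_conv_nth)
  ultimately show ?thesis by simp
qed

definition literal_of :: "nat \<Rightarrow> literal" where
  "literal_of u = (u div 2 - 2, odd u)"

lemma literal_of_lit_bank [simp]: "literal_of (lit_bank (x, b)) = (x, b)"
  by (auto simp: literal_of_def lit_bank_def)

definition clause_assets :: "bool list \<Rightarrow> nat \<Rightarrow> nat" where
  "clause_assets \<alpha> c = (\<Sum>k\<leftarrow>[0..<length (occs \<phi>)]. if snd (occs \<phi> ! k) = c \<and>
     \<alpha> ! fst (fst (occs \<phi> ! k)) = snd (fst (occs \<phi> ! k)) then occ_weight \<phi> k else 0)"

text \<open>The candidate for the clearing state. It is kept in \<open>nat\<close>, so that the sums
  are compared there and cast to reals just once.\<close>

definition bank_assets :: "bool list \<Rightarrow> nat \<Rightarrow> nat" where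
  "bank_assets \<alpha> u =
    (if u = 0 then (\<Sum>c\<leftarrow>[0..<length (clauses \<phi>)]. min (snd (clauses \<phi> ! c)) (clause_assets \<alpha> c))
     else if u < 4 then externals \<phi> u
     else if u < 4 + 2 * num_vars \<phi> then
       (case literal_of u of (x, b) \<Rightarrow> if \<alpha> ! x = b then var_weight \<phi> x else 0)
     else clause_assets \<alpha> (u - (4 + 2 * num_vars \<phi>)))"

text \<open>An occurrence weight exceeds every clause weight. So one true literal is enough to pay
  the clause weight in full, further ones do not raise the payment, and without a true literal
  nothing arrives.\<close>

lemma min_clause_assets:
  assumes "c < length (clauses \<phi>)"
  shows "min (snd (clauses \<phi> ! c)) (clause_assets \<alpha> c) =
    (if satisfies \<alpha> (fst (clauses \<phi> ! c)) then snd (clauses \<phi> ! c) else 0)"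
proof (cases "satisfies \<alpha> (fst (clauses \<phi> ! c))")
  case True
  then obtain k where k: "k < length (occs \<phi>)" "snd (occs \<phi> ! k) = c"
    "\<alpha> ! fst (fst (occs \<phi> ! k)) = snd (fst (occs \<phi> ! k))"
    using satisfies_occs[OF assms] by blast
  have "snd (clauses \<phi> ! c) < 2 ^ weight_bits \<phi>" by (rule clause_weight_less[OF assms])
  also have "\<dots> \<le> occ_weight \<phi> k" unfolding occ_weight_def by (intro power_increasing) auto
  also have "\<dots> \<le> clause_assets \<alpha> c"
    unfolding clause_assets_def
    by (rule member_le_sum_list) (use k in \<open>auto intro!: rev_image_eqI[of k]\<close>)
  finally show ?thesis using True by simp
next
  case False
  then have "clause_assets \<alpha> c = 0"
    using satisfies_occs[OF assms] by (auto simp: clause_assets_def)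
  with False show ?thesis by simp
qed

lemma bank_assets_simps [simp]:
  "u < 4 \<Longrightarrow> u \<noteq> 0 \<Longrightarrow> bank_assets \<alpha> u = externals \<phi> u"
  "x < num_vars \<phi> \<Longrightarrow> bank_assets \<alpha> (lit_bank (x, b)) = (if \<alpha> ! x = b then var_weight \<phi> x else 0)"
  "bank_assets \<alpha> (clause_bank \<phi> c) = clause_assets \<alpha> c"
proof -
  assume "x < num_vars \<phi>"
  then have "lit_bank (x, b) < 4 + 2 * num_vars \<phi>" "\<not> lit_bank (x, b) < 4"
    by (auto simp: lit_bank_def)
  then show "bank_assets \<alpha> (lit_bank (x, b)) = (if \<alpha> ! x = b then var_weight \<phi> x else 0)"
    by (simp add: bank_assets_def)
qed (auto simp: bank_assets_def clause_bank_def)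

lemma bank_cases:
  assumes "u < num_banks \<phi>"
  obtains "u = 0" | "u = 1" | "u = 2" | "u = 3"
  | x b where "x < num_vars \<phi>" "u = lit_bank (x, b)"
  | c where "c < length (clauses \<phi>)" "u = clause_bank \<phi> c"
proof -
  consider "u = 0" | "u = 1" | "u = 2" | "u = 3" | "4 \<le> u" "u < 4 + 2 * num_vars \<phi>"
    | "4 + 2 * num_vars \<phi> \<le> u" by linarith
  then show thesis
  proof cases
    case 5
    then have "u div 2 - 2 < num_vars \<phi>" "u = lit_bank (u div 2 - 2, odd u)"
      unfolding lit_bank_def by (cases "odd u"; auto elim!: oddE evenE)+
    then show thesis by (rule that(5))
  next
    case 6
    then show thesis
      using assms by (intro that(6)[of "u - (4 + 2 * num_vars \<phi>)"]) (auto simp: num_banks_def clause_bank_def)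
  qed (use that in auto)
qed

text \<open>Bank 1 and the banks of true literals cover all their stubs, by the geometric sum; for a
  literal its occurrences are simply bounded by all occurrences. Banks 2 and 3 and the false
  literals have nothing, a clause has one stub, and the target has none.\<close>

lemma bank_assets_out_weights:
  assumes "u < num_banks \<phi>"
  shows "bank_assets \<alpha> u = 0 \<or> sum_list (out_weights (edges \<phi> \<alpha>) u) \<le> bank_assets \<alpha> u \<or>
    length (out_weights (edges \<phi> \<alpha>) u) \<le> 1"
  using assms
proof (cases rule: bank_cases)
  case 1
  then have "out_weights (edges \<phi> \<alpha>) u = []"
    by (auto simp: out_weights_def filter_src_edges occ_edges_def clause_edges_def filter_empty_conv
        lit_bank_def clause_bank_def case_prod_unfold)
  then show ?thesis by simp
next
  case 2
  then have "sum_list (out_weights (edges \<phi> \<alpha>) u) = (\<Sum>x\<leftarrow>[0..<num_vars \<phi>]. var_weight \<phi> x)"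
    using out_weights_edges(1) by simp
  also have "\<dots> \<le> bank_assets \<alpha> u"
    using 2 sum_two_powers[of "weight_bits \<phi> + length (occs \<phi>)" "num_vars \<phi>"]
    by (simp add: externals_def var_weight_def)
  finally show ?thesis by simp
next
  case (5 x b)
  show ?thesis
  proof (cases "\<alpha> ! x = b")
    case True
    have "u \<noteq> 1" "u \<noteq> 2" using 5 by auto
    have "out_weights (edges \<phi> \<alpha>) u = map wt (filter (\<lambda>e. src e = u) (occ_edges \<phi> @ clause_edges \<phi>))"
      unfolding out_weights_def filter_src_edges(3)[OF \<open>u \<noteq> 1\<close> \<open>u \<noteq> 2\<close>] ..
    also have "\<dots> = map wt (filter (\<lambda>e. src e = u) (occ_edges \<phi>))"
      using 5 by (auto simp: clause_edges_def filter_empty_conv lit_bank_def clause_bank_def)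
    finally have "sum_list (out_weights (edges \<phi> \<alpha>) u) \<le> sum_list (map wt (occ_edges \<phi>))"
      by (simp add: sum_list_filter_le_nat)
    also have "\<dots> < 2 ^ (weight_bits \<phi> + length (occs \<phi>))"
      using sum_two_powers[of "weight_bits \<phi>" "length (occs \<phi>)"]
      by (simp add: occ_edges_def occ_weight_def comp_def)
    also have "\<dots> \<le> bank_assets \<alpha> u"
      using 5 True by (simp add: var_weight_def)
    finally show ?thesis by simp
  qed (use 5 in simp)
next
  case (6 c)
  then have "u \<noteq> 1" "u \<noteq> 2" by (auto simp: clause_bank_def)
  have "filter (\<lambda>e. src e = u) (occ_edges \<phi>) = []"
  proof -
    have "src e \<noteq> u" if "e \<in> set (occ_edges \<phi>)" for e
    proof
      assume "src e = u"
      have "e \<in> set (edges \<phi> \<alpha>)" using that by (simp add: edges_def)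
      moreover have "dst e \<noteq> 0" using that by (auto simp: occ_edges_def clause_bank_def)
      ultimately show False
        using 6 \<open>src e = u\<close> by (cases rule: edgesE) (auto simp: lit_bank_neq_clause_bank, simp_all add: clause_bank_def)
    qed
    then show ?thesis by (simp add: filter_empty_conv)
  qed
  moreover have "filter (\<lambda>d. clause_bank \<phi> d = u) [0..<length (clauses \<phi>)] = [c]"
    using 6 by (intro filter_upt_unique) (auto simp: clause_bank_def)
  ultimately show ?thesis
    unfolding out_weights_def filter_src_edges(3)[OF \<open>u \<noteq> 1\<close> \<open>u \<noteq> 2\<close>]
    by (simp add: clause_edges_def filter_map comp_def)
qed (simp_all add: externals_def)

lemma sum_list_upt_delta:
  "(\<Sum>y\<leftarrow>[0..<n]. if y = x then f y else 0) = (if x < n then f x else (0::nat))"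
  by (induction n) auto

text \<open>These are the clearing equations with payments written as minima. A bank receives money
  from at most one of the three groups of edges: literals from the first, clauses from the second,
  the target from the third.\<close>

lemma bank_assets_inflow:
  assumes "w < num_banks \<phi>"
  shows "bank_assets \<alpha> w = externals \<phi> w +
    (\<Sum>e\<leftarrow>edges \<phi> \<alpha>. if dst e = w then min (wt e) (bank_assets \<alpha> (src e)) else 0)"
proof -
  let ?f = "\<lambda>e. if dst e = w then min (wt e) (bank_assets \<alpha> (src e)) else 0"
  have occ: "fst (occs \<phi> ! k) = (fst (fst (occs \<phi> ! k)), snd (fst (occs \<phi> ! k)))"
    "fst (fst (occs \<phi> ! k)) < num_vars \<phi>" "snd (occs \<phi> ! k) < length (clauses \<phi>)"
    if "k < length (occs \<phi>)" for k
    using nth_mem[OF that] mem_occs clause_valid(1) by (metis prod.collapse)+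
  have var: "sum_list (map ?f (var_edges \<phi> \<alpha>)) =
      (\<Sum>x\<leftarrow>[0..<num_vars \<phi>]. if lit_bank (x, \<alpha> ! x) = w then var_weight \<phi> x else 0)"
  proof -
    have "min (var_weight \<phi> x) (externals \<phi> 1) = var_weight \<phi> x" if "x < num_vars \<phi>" for x
      using that unfolding var_weight_def externals_def by (simp add: power_increasing min_absorb1)
    then have 1: "map (?f \<circ> (\<lambda>x. (1, lit_bank (x, \<alpha> ! x), var_weight \<phi> x))) [0..<num_vars \<phi>] =
        map (\<lambda>x. if lit_bank (x, \<alpha> ! x) = w then var_weight \<phi> x else 0) [0..<num_vars \<phi>]"
      by (intro map_cong) auto
    have 2: "map (?f \<circ> (\<lambda>x. (2, lit_bank (x, \<not> \<alpha> ! x), var_weight \<phi> x))) [0..<num_vars \<phi>] =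
        map (\<lambda>x. 0) [0..<num_vars \<phi>]"
      by (intro map_cong) (auto simp: externals_def)
    show ?thesis
      unfolding var_edges_def map_append map_map sum_list_append 1 2 by simp
  qed
  have occ_sum: "sum_list (map ?f (occ_edges \<phi>)) =
    (\<Sum>k\<leftarrow>[0..<length (occs \<phi>)]. if clause_bank \<phi> (snd (occs \<phi> ! k)) = w \<and>
       \<alpha> ! fst (fst (occs \<phi> ! k)) = snd (fst (occs \<phi> ! k)) then occ_weight \<phi> k else 0)"
  proof -
    have "min (occ_weight \<phi> k) (bank_assets \<alpha> (lit_bank (fst (occs \<phi> ! k)))) =
      (if \<alpha> ! fst (fst (occs \<phi> ! k)) = snd (fst (occs \<phi> ! k)) then occ_weight \<phi> k else 0)"
      if "k < length (occs \<phi>)" for k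
    proof -
      have "occ_weight \<phi> k \<le> var_weight \<phi> x" for x
        using that unfolding occ_weight_def var_weight_def by (intro power_increasing) auto
      then show ?thesis
        using occ[OF that] bank_assets_simps(2) by (metis min_0R min_absorb1)
    qed
    then show ?thesis
      unfolding occ_edges_def map_map by (intro arg_cong[where f = sum_list] map_cong) auto
  qed
  have clause_sum: "sum_list (map ?f (clause_edges \<phi>)) = (if w = 0 then bank_assets \<alpha> 0 else 0)"
    by (auto simp: clause_edges_def comp_def bank_assets_def[of _ 0])
  have sum: "(\<Sum>e\<leftarrow>edges \<phi> \<alpha>. ?f e) =
      (\<Sum>x\<leftarrow>[0..<num_vars \<phi>]. if lit_bank (x, \<alpha> ! x) = w then var_weight \<phi> x else 0) +
      (\<Sum>k\<leftarrow>[0..<length (occs \<phi>)]. if clause_bank \<phi> (snd (occs \<phi> ! k)) = w \<and>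
       \<alpha> ! fst (fst (occs \<phi> ! k)) = snd (fst (occs \<phi> ! k)) then occ_weight \<phi> k else 0) +
      (if w = 0 then bank_assets \<alpha> 0 else 0)"
    by (simp add: edges_def var occ_sum clause_sum)
  have small: ?thesis if "w < 4"
  proof -
    have "lit_bank (x, b) \<noteq> w" "clause_bank \<phi> c \<noteq> w" for x b c
      using that by (auto simp: lit_bank_def clause_bank_def)
    then show ?thesis
      unfolding sum using that by (cases "w = 0") (simp_all add: externals_def clause_bank_def)
  qed
  from assms show ?thesis
  proof (cases rule: bank_cases)
    case (5 x b)
    have "(\<Sum>y\<leftarrow>[0..<num_vars \<phi>]. if lit_bank (y, \<alpha> ! y) = w then var_weight \<phi> y else 0) =
      (\<Sum>y\<leftarrow>[0..<num_vars \<phi>]. if y = x then (if \<alpha> ! x = b then var_weight \<phi> x else 0) else 0)"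
      unfolding 5 by (intro arg_cong[where f = sum_list] map_cong) auto
    moreover have "clause_bank \<phi> c \<noteq> w" for c using 5 by (auto simp: lit_bank_def clause_bank_def)
    ultimately show ?thesis
      unfolding sum using 5 by (simp add: sum_list_upt_delta externals_def)
  next
    case (6 c)
    have "lit_bank (x, b) \<noteq> w" if "x < num_vars \<phi>" for x b
      using that 6 by (auto simp: lit_bank_def clause_bank_def)
    then have v0: "(\<Sum>y\<leftarrow>[0..<num_vars \<phi>]. if lit_bank (y, \<alpha> ! y) = w then var_weight \<phi> y else 0) = 0"
      by auto
    have cb: "clause_bank \<phi> d = w \<longleftrightarrow> d = c" for d using 6 by (auto simp: clause_bank_def)
    have ext: "externals \<phi> w = 0" "w \<noteq> 0" using 6 by (auto simp: externals_def clause_bank_def)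
    have val: "bank_assets \<alpha> w = clause_assets \<alpha> c" using 6 by simp
    show ?thesis
      unfolding sum v0 cb ext(1) val clause_assets_def using ext(2) by simp
  qed (rule small, simp)+
qed

text \<open>Equality of the objectives, not just agreement of their order, settles both the local
  optima and the arcs of the transition graphs.\<close>

lemma objective_reduced_network:
  assumes len: "length \<alpha> = num_vars \<phi>"
  shows "objective max_assets (reduced_instance \<phi>) (reduced_network \<phi> \<alpha>) = objective max_2_sat \<phi> \<alpha>"
proof -
  let ?E = "edges \<phi> \<alpha>"
  \<comment> \<open>The levels follow the flow of money: banks 1 and 2, literals, clauses, target.
    Bank 0 is the target and so has the highest level.\<close>
  let ?lev = "\<lambda>u. if u = 0 then 3 else if u < 4 then 0 else if u < 4 + 2 * num_vars \<phi> then 1 else (2::nat)"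
  have "clearing_state (system_of (num_banks \<phi>) (externals \<phi>) ?E) (network_of (num_banks \<phi>) ?E) =
      map (\<lambda>u. real (bank_assets \<alpha> u)) [0..<num_banks \<phi>]"
  proof (rule clearing_state_acyclic[OF edges_bounds, where lev = ?lev])
    fix e assume "e \<in> set ?E"
    then show "?lev (src e) < ?lev (dst e)"
      by (cases rule: edgesE) (auto simp: lit_bank_def clause_bank_def)
  next
    fix u assume "u < num_banks \<phi>"
    from bank_assets_out_weights[OF this, of \<alpha>]
    show "real (bank_assets \<alpha> u) = 0 \<or> real (sum_list (out_weights ?E u)) \<le> real (bank_assets \<alpha> u) \<or>
        length (out_weights ?E u) \<le> 1" by auto
  next
    fix w assume "w < num_banks \<phi>"
    from bank_assets_inflow[OF this, of \<alpha>]
    have "real (bank_assets \<alpha> w) = real (externals \<phi> w) +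
      real (\<Sum>e\<leftarrow>?E. if dst e = w then min (wt e) (bank_assets \<alpha> (src e)) else 0)" by simp
    also have "real (\<Sum>e\<leftarrow>E. if dst e = w then min (wt e) (bank_assets \<alpha> (src e)) else 0) =
      (\<Sum>e\<leftarrow>E. if dst e = w then min (real (wt e)) (real (bank_assets \<alpha> (src e))) else 0)" for E
      by (induction E) (auto simp: of_nat_min)
    finally show "real (bank_assets \<alpha> w) = real (externals \<phi> w) +
      (\<Sum>e\<leftarrow>?E. if dst e = w then min (real (wt e)) (real (bank_assets \<alpha> (src e))) else 0)" .
  qed simp_all
  then have "objective max_assets (reduced_instance \<phi>) (reduced_network \<phi> \<alpha>) = real (bank_assets \<alpha> 0)"
    by (simp add: max_assets_def reduced_network_def reduced_instance_eq[of \<alpha>] num_banks_gt)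
  also have "bank_assets \<alpha> 0 = (\<Sum>c\<leftarrow>[0..<length (clauses \<phi>)].
      if satisfies \<alpha> (fst (clauses \<phi> ! c)) then snd (clauses \<phi> ! c) else 0)"
    by (auto simp: bank_assets_def min_clause_assets intro!: arg_cong[where f = sum_list])
  also have "\<dots> = (\<Sum>(C, w) \<leftarrow> clauses \<phi>. if satisfies \<alpha> C then w else 0)"
    by (auto simp: sum_list_sum_nth case_prod_unfold intro!: sum.cong)
  finally show ?thesis by (simp add: max_2_sat_def)
qed

end

section \<open>Computing the reduction\<close>

lemma enc_pair_eq: "enc_pair e1 e2 p = Node (e1 (fst p)) (e2 (snd p))"
  by (cases p) simp

abbreviation enc_clause :: "wclause \<Rightarrow> tree" where
  "enc_clause \<equiv> enc_pair (enc_list (enc_pair enc_nat enc_bool)) enc_nat"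

abbreviation enc_edge :: "edge \<Rightarrow> tree" where
  "enc_edge \<equiv> enc_pair enc_nat (enc_pair enc_nat enc_nat)"

text \<open>As \<open>4 + 2 * x + b = 2 * (x + 2) + b\<close>, the sign is the lowest bit and the
  remaining bits represent \<open>x + 2\<close>; no doubling or addition has to be
  programmed.\<close>

lemma enc_nat_lit_bank:
  "enc_nat (lit_bank l) = Node (enc_bool (snd l)) (bin_suc (bin_suc (enc_nat (fst l))))"
proof -
  have "lit_bank l = 2 * Suc (Suc (fst l)) + of_bool (snd l)"
    by (simp add: lit_bank_def case_prod_unfold)
  then show ?thesis
    by (simp only: bin_suc_enc_nat enc_nat_double[OF disjI1[OF zero_less_Suc]])
qed

lemma enc_bool_not: "(if enc_bool b = Leaf then Node Leaf Leaf else Leaf) = enc_bool (\<not> b)"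
  by (cases b) auto

text \<open>The concatenated binary clause weights, used as a unary number: the length of this list
  is \<open>weight_bits\<close>.\<close>

definition bits_tree :: "tree \<Rightarrow> tree" where
  "bits_tree cs = tree_of (concat (map (\<lambda>x. list_of (right x)) (list_of cs)))"

definition occs_tree :: "tree \<Rightarrow> tree" where
  "occs_tree cs = tree_of (concat (map
     (\<lambda>p. list_of (tree_of (map (\<lambda>l. Node l (left p)) (list_of (left (right p))))))
     (list_of (number cs))))"

text \<open>The argument of \<open>edges_tree\<close> is \<open>Node (Node vs cs) \<alpha>\<close> with the variables \<open>vs\<close> and the clauses \<open>cs\<close> of
  a formula; \<open>system_tree\<close> and \<open>network_tree\<close> expect a list of edges in place of \<open>\<alpha>\<close>.\<close>

definition edges_tree :: "tree \<Rightarrow> tree" where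
  "edges_tree t =
    tree_append (tree_of (map (\<lambda>p. Node (enc_nat 1)
        (Node (Node (right p) (bin_suc (bin_suc (bin (left p)))))
          (power_two (tree_append (bits_tree (right (left t))) (tree_append (occs_tree (right (left t))) (left p))))))
        (list_of (number (right t)))))
    (tree_append (tree_of (map (\<lambda>p. Node (enc_nat 2)
        (Node (Node (if right p = Leaf then Node Leaf Leaf else Leaf) (bin_suc (bin_suc (bin (left p)))))
          (power_two (tree_append (bits_tree (right (left t))) (tree_append (occs_tree (right (left t))) (left p))))))
        (list_of (number (right t)))))
    (tree_append (tree_of (map (\<lambda>p. Node
        (Node (right (left (right p))) (bin_suc (bin_suc (left (left (right p))))))
        (Node (bin (tree_append (unary 4) (tree_append (left (left t)) (tree_append (left (left t)) (right (right p))))))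
          (power_two (tree_append (bits_tree (right (left t))) (left p)))))
        (list_of (number (occs_tree (right (left t)))))))
    (tree_of (map (\<lambda>p. Node
        (bin (tree_append (unary 4) (tree_append (left (left t)) (tree_append (left (left t)) (left p)))))
        (Node Leaf (right (right p))))
        (list_of (number (right (left t))))))))"

text \<open>A list with one entry per bank, obtained by concatenation; its unary indices are the
  bank numbers, and mapping over it is the loop over all banks.\<close>

definition banks_tree :: "tree \<Rightarrow> tree" where
  "banks_tree t = number (tree_append (unary 4) (tree_append (left t) (tree_append (left t) (right t))))"

definition system_tree :: "tree \<Rightarrow> tree" where
  "system_tree t = tree_of (map (\<lambda>p. Node
      (if bin (left p) = enc_nat 1 then power_two (tree_append (bits_tree (right (left t)))
        (tree_append (occs_tree (right (left t))) (left (left t)))) else Leaf)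
      (Node
        (tree_of (map (\<lambda>e. right (right e))
          (list_of (tree_of (filter (\<lambda>e. left e = bin (left p)) (list_of (right t)))))))
        (tree_of (map (\<lambda>e. right (right e))
          (list_of (tree_of (filter (\<lambda>e. left (right e) = bin (left p)) (list_of (right t)))))))))
      (list_of (banks_tree (left t))))"

definition network_tree :: "tree \<Rightarrow> tree" where
  "network_tree t = tree_of (map (\<lambda>p. tree_of (map (\<lambda>e. left (right e))
      (list_of (tree_of (filter (\<lambda>e. left e = bin (left p)) (list_of (right t)))))))
      (list_of (banks_tree (left t))))"

lemma ptime_bits_tree: "ptime f \<Longrightarrow> ptime (\<lambda>t. bits_tree (f t))"
  by (rule ptime_comp) (unfold bits_tree_def, intro ptime_intros)

lemma ptime_occs_tree: "ptime f \<Longrightarrow> ptime (\<lambda>t. occs_tree (f t))"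
  by (rule ptime_comp) (unfold occs_tree_def, intro ptime_intros)

lemma ptime_edges_tree: "ptime f \<Longrightarrow> ptime (\<lambda>t. edges_tree (f t))"
  by (rule ptime_comp)
    (unfold edges_tree_def, intro ptime_intros ptime_bits_tree ptime_occs_tree)

lemma ptime_system_tree: "ptime f \<Longrightarrow> ptime (\<lambda>t. system_tree (f t))"
  by (rule ptime_comp)
    (unfold system_tree_def banks_tree_def, intro ptime_intros ptime_bits_tree ptime_occs_tree)

lemma ptime_network_tree: "ptime f \<Longrightarrow> ptime (\<lambda>t. network_tree (f t))"
  by (rule ptime_comp) (unfold network_tree_def banks_tree_def, intro ptime_intros)

section \<open>The programs produce the encodings of the construction\<close>

lemma list_of_number_conv:
  "list_of (number t) = map (\<lambda>i. Node (unary i) (list_of t ! i)) [0..<length (list_of t)]"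
  by (auto simp: enumerate_eq_zip intro!: nth_equalityI)

lemma map_number:
  assumes "\<And>i. i < length (list_of t) \<Longrightarrow> f (Node (unary i) (list_of t ! i)) = enc (g i)"
  shows "tree_of (map f (list_of (number t))) = enc_list enc (map g [0..<length (list_of t)])"
  using assms unfolding list_of_number_conv enc_list_eq[of enc] map_map
  by (intro arg_cong[where f = tree_of] map_cong) auto

lemma append_enc_list: "tree_append (enc_list e xs) (enc_list e ys) = enc_list e (xs @ ys)"
  by (simp add: tree_append_def enc_list_eq[of e])

lemma length_bits_tree:
  "length (list_of (bits_tree (enc_list enc_clause (clauses \<phi>)))) = weight_bits \<phi>"
  by (simp add: bits_tree_def weight_bits_def length_concat comp_def enc_pair_eq bit_length_def
      case_prod_unfold)

lemma occs_tree_enc: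
  "occs_tree (enc_list enc_clause (clauses \<phi>)) =
    tree_of (map (\<lambda>(l, c). Node (enc_pair enc_nat enc_bool l) (unary c)) (occs \<phi>))"
proof -
  have "map (\<lambda>p. list_of (tree_of (map (\<lambda>l. Node l (left p)) (list_of (left (right p))))))
      (list_of (number (enc_list enc_clause (clauses \<phi>)))) =
    map (\<lambda>c. map (\<lambda>(l, c). Node (enc_pair enc_nat enc_bool l) (unary c))
      (map (\<lambda>l. (l, c)) (fst (clauses \<phi> ! c)))) [0..<length (clauses \<phi>)]"
    unfolding list_of_number_conv by (auto simp: enc_pair_eq[of _ enc_nat])
  then show ?thesis
    unfolding occs_tree_def occs_def map_concat map_map by (simp add: comp_def)
qed

lemma edges_tree_enc:
  assumes len: "length \<alpha> = num_vars \<phi>" and vs: "length (list_of vs) = num_vars \<phi>"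
  shows "edges_tree (Node (Node vs (enc_list enc_clause (clauses \<phi>))) (enc_list enc_bool \<alpha>)) =
    enc_list enc_edge (edges \<phi> \<alpha>)"
proof -
  let ?cs = "enc_list enc_clause (clauses \<phi>)"
  have occs_len: "length (list_of (occs_tree ?cs)) = length (occs \<phi>)"
    by (simp add: occs_tree_enc)
  note simps = enc_pair_eq[of enc_nat] power_two_eq bin_eq length_bits_tree occs_len
  have 1: "tree_of (map (\<lambda>p. Node (enc_nat 1)
        (Node (Node (right p) (bin_suc (bin_suc (bin (left p)))))
          (power_two (tree_append (bits_tree ?cs) (tree_append (occs_tree ?cs) (left p))))))
        (list_of (number (enc_list enc_bool \<alpha>)))) =
    enc_list enc_edge (map (\<lambda>x. (1, lit_bank (x, \<alpha> ! x), var_weight \<phi> x)) [0..<num_vars \<phi>])"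
    by (subst map_number[where enc = enc_edge])
      (auto simp: simps len enc_nat_lit_bank enc_bool_not var_weight_def add.assoc simp del: bin_suc_enc_nat)
  have 2: "tree_of (map (\<lambda>p. Node (enc_nat 2)
        (Node (Node (if right p = Leaf then Node Leaf Leaf else Leaf) (bin_suc (bin_suc (bin (left p)))))
          (power_two (tree_append (bits_tree ?cs) (tree_append (occs_tree ?cs) (left p))))))
        (list_of (number (enc_list enc_bool \<alpha>)))) =
    enc_list enc_edge (map (\<lambda>x. (2, lit_bank (x, \<not> \<alpha> ! x), var_weight \<phi> x)) [0..<num_vars \<phi>])"
    by (subst map_number[where enc = enc_edge])
      (auto simp: simps len enc_nat_lit_bank enc_bool_not var_weight_def add.assoc simp del: bin_suc_enc_nat)
  have 3: "tree_of (map (\<lambda>p. Node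
        (Node (right (left (right p))) (bin_suc (bin_suc (left (left (right p))))))
        (Node (bin (tree_append (unary 4) (tree_append vs (tree_append vs (right (right p))))))
          (power_two (tree_append (bits_tree ?cs) (left p)))))
        (list_of (number (occs_tree ?cs)))) = enc_list enc_edge (occ_edges \<phi>)"
    unfolding occ_edges_def occs_len[symmetric]
    by (rule map_number)
      (auto simp: simps vs enc_nat_lit_bank occ_weight_def clause_bank_def occs_tree_enc
        case_prod_unfold algebra_simps simp del: bin_suc_enc_nat)
  have 4: "tree_of (map (\<lambda>p. Node
        (bin (tree_append (unary 4) (tree_append vs (tree_append vs (left p)))))
        (Node Leaf (right (right p)))) (list_of (number ?cs))) = enc_list enc_edge (clause_edges \<phi>)"
    unfolding clause_edges_def
    by (subst map_number[where enc = enc_edge])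
      (auto simp: simps vs clause_bank_def enc_pair_eq algebra_simps)
  show ?thesis
    unfolding edges_tree_def left.simps right.simps 1 2 3 4 append_enc_list
    by (simp add: edges_def var_edges_def)
qed

lemma list_of_banks_tree:
  assumes "length (list_of vs) = num_vars \<phi>"
  obtains f where "list_of (banks_tree (Node vs (enc_list enc_clause (clauses \<phi>)))) =
    map (\<lambda>u. Node (unary u) (f u)) [0..<num_banks \<phi>]"
proof -
  let ?t = "tree_append (unary 4) (tree_append vs (tree_append vs (enc_list enc_clause (clauses \<phi>))))"
  have "length (list_of ?t) = num_banks \<phi>"
    using assms by (simp add: num_banks_def)
  then have "list_of (banks_tree (Node vs (enc_list enc_clause (clauses \<phi>)))) =
      map (\<lambda>u. Node (unary u) (list_of ?t ! u)) [0..<num_banks \<phi>]"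
    unfolding banks_tree_def list_of_number_conv left.simps right.simps by (simp only:)
  then show thesis by (rule that)
qed

lemma filter_enc_list:
  assumes "\<And>x. x \<in> set xs \<Longrightarrow> P (e x) \<longleftrightarrow> Q x" "\<And>x. x \<in> set xs \<Longrightarrow> f (e x) = e' (g x)"
  shows "tree_of (map f (list_of (tree_of (filter P (list_of (enc_list e xs)))))) =
    enc_list e' (map g (filter Q xs))"
  unfolding enc_list_eq[of e'] using assms by (induction xs) auto

lemma system_tree_enc:
  assumes vs: "length (list_of vs) = num_vars \<phi>"
  shows "system_tree (Node (Node vs (enc_list enc_clause (clauses \<phi>))) (enc_list enc_edge E)) =
    enc_list (\<lambda>B. enc_pair enc_nat (enc_pair (enc_list enc_nat) (enc_list enc_nat))
      (external B, outgoing B, incoming B)) (banks (system_of (num_banks \<phi>) (externals \<phi>) E))"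
    (is "_ = enc_list ?e _")
proof -
  obtain f where f: "list_of (banks_tree (Node vs (enc_list enc_clause (clauses \<phi>)))) =
    map (\<lambda>u. Node (unary u) (f u)) [0..<num_banks \<phi>]" using list_of_banks_tree[OF vs] .
  have occs_len: "length (list_of (occs_tree (enc_list enc_clause (clauses \<phi>)))) = length (occs \<phi>)"
    by (simp add: occs_tree_enc)
  have out: "tree_of (map (\<lambda>e. right (right e))
      (list_of (tree_of (filter (\<lambda>e. left e = enc_nat u) (list_of (enc_list enc_edge E)))))) =
    enc_list enc_nat (out_weights E u)" for u
    unfolding out_weights_def
    by (rule filter_enc_list) (auto simp: enc_pair_eq enc_nat_inject)
  have inc: "tree_of (map (\<lambda>e. right (right e))
      (list_of (tree_of (filter (\<lambda>e. left (right e) = enc_nat u) (list_of (enc_list enc_edge E)))))) =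
    enc_list enc_nat (in_weights E u)" for u
    unfolding in_weights_def
    by (rule filter_enc_list) (auto simp: enc_pair_eq enc_nat_inject)
  show ?thesis
    unfolding system_tree_def left.simps right.simps f map_map enc_list_eq[of ?e]
      system_of_def stub_system.simps
    by (intro arg_cong[where f = tree_of] map_cong)
      (auto simp: bin_eq out inc enc_nat_inject power_two_eq length_bits_tree occs_len vs externals_def
        simp del: list_of_enc_list list_of_tree_of)
qed

lemma network_tree_enc:
  assumes vs: "length (list_of vs) = num_vars \<phi>"
  shows "network_tree (Node (Node vs (enc_list enc_clause (clauses \<phi>))) (enc_list enc_edge E)) =
    enc_list (enc_list enc_nat) (network_of (num_banks \<phi>) E)"
proof -
  obtain f where f: "list_of (banks_tree (Node vs (enc_list enc_clause (clauses \<phi>)))) =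
    map (\<lambda>u. Node (unary u) (f u)) [0..<num_banks \<phi>]" using list_of_banks_tree[OF vs] .
  have cred: "tree_of (map (\<lambda>e. left (right e))
      (list_of (tree_of (filter (\<lambda>e. left e = enc_nat u) (list_of (enc_list enc_edge E)))))) =
    enc_list enc_nat (creditors E u)" for u
    unfolding creditors_def
    by (rule filter_enc_list) (auto simp: enc_pair_eq enc_nat_inject)
  show ?thesis
    unfolding network_tree_def left.simps right.simps f map_map enc_list_eq[of "enc_list _"]
      network_of_def
    by (intro arg_cong[where f = tree_of] map_cong) (auto simp: bin_eq cred simp del: list_of_enc_list list_of_tree_of)
qed

section \<open>Polynomial time and tightness\<close>

lemma enc_instance_max_2_sat:
  "enc_instance max_2_sat \<phi> =
    Node (enc_list (\<lambda>_. Leaf) [0..<num_vars \<phi>]) (enc_list enc_clause (clauses \<phi>))"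
  by (simp add: max_2_sat_def)

lemma polytime_reduced_instance:
  "polytime_on (instances max_2_sat) (enc_instance max_2_sat) (enc_instance max_assets) reduced_instance"
proof (rule polytime_onI)
  \<comment> \<open>A list of leaves, one for each variable, encodes the all-false assignment, and
    the final \<open>Leaf\<close> encodes the target 0.\<close>
  let ?F = "\<lambda>t. Node (system_tree (Node t (edges_tree (Node t
    (tree_of (map (\<lambda>_. Leaf) (list_of (left t)))))))) Leaf"
  show "ptime ?F"
    by (intro ptime_intros ptime_system_tree ptime_edges_tree)
  fix \<phi> :: cnf
  have "tree_of (map (\<lambda>_. Leaf) (list_of (left (enc_instance max_2_sat \<phi>)))) =
      enc_list enc_bool (replicate (num_vars \<phi>) False)"
    by (simp add: enc_instance_max_2_sat enc_list_eq[of enc_bool] comp_def map_replicate_const)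
  then show "?F (enc_instance max_2_sat \<phi>) = enc_instance max_assets (reduced_instance \<phi>)"
    unfolding enc_instance_max_2_sat
    by (simp add: edges_tree_enc system_tree_enc max_assets_def reduced_instance_def system_of_def)
qed

lemma polytime_reduced_network:
  "polytime_on (SIGMA \<phi> : instances max_2_sat. feasible max_2_sat \<phi>)
    (enc_pair (enc_instance max_2_sat) (enc_solution max_2_sat)) (enc_solution max_assets)
    (\<lambda>(\<phi>, \<alpha>). reduced_network \<phi> \<alpha>)"
proof (rule polytime_onI)
  let ?F = "\<lambda>t. network_tree (Node (left t) (edges_tree t))"
  show "ptime ?F"
    by (intro ptime_intros ptime_network_tree ptime_edges_tree)
  fix p assume "p \<in> (SIGMA \<phi> : instances max_2_sat. feasible max_2_sat \<phi>)"
  then obtain \<phi> \<alpha> where p: "p = (\<phi>, \<alpha>)" "length \<alpha> = num_vars \<phi>"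
    by (auto simp: max_2_sat_def)
  have "enc_solution max_2_sat \<alpha> = enc_list enc_bool \<alpha>"
    by (simp add: max_2_sat_def)
  with p show "?F (enc_pair (enc_instance max_2_sat) (enc_solution max_2_sat) p) =
      enc_solution max_assets ((\<lambda>(\<phi>, \<alpha>). reduced_network \<phi> \<alpha>) p)"
    by (simp add: enc_instance_max_2_sat edges_tree_enc network_tree_enc max_assets_def reduced_network_def)
qed

text \<open>On consistent networks the second row consists of literal banks. The first bit of such a
  bank number is already the encoded truth value, so \<open>left\<close> extracts it.\<close>

lemma polytime_assignment_of:
  "polytime_on (SIGMA \<phi> : instances max_2_sat. feasible max_assets (reduced_instance \<phi>))
    (enc_pair (enc_instance max_2_sat) (enc_solution max_assets)) (enc_solution max_2_sat)
    (\<lambda>(\<phi>, N). assignment_of N)"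
proof (rule polytime_onI)
  let ?F = "\<lambda>t. tree_of (map (\<lambda>x. left x) (list_of (left (right (right t)))))"
  show "ptime ?F"
    by (intro ptime_intros)
  fix p assume "p \<in> (SIGMA \<phi> : instances max_2_sat. feasible max_assets (reduced_instance \<phi>))"
  then obtain \<phi> N where p: "p = (\<phi>, N)" and valid: "\<phi> \<in> instances max_2_sat"
    and cons: "consistent (reduced_instance \<phi>) N"
    by (auto simp: max_assets_def)
  define \<alpha> where "\<alpha> = assignment_of N"
  have N: "N = reduced_network \<phi> \<alpha>" and len: "length \<alpha> = num_vars \<phi>"
    using consistent_eq[OF valid cons] by (simp_all add: \<alpha>_def)
  have "1 < length N" using N by (simp add: reduced_network_def num_banks_def)
  then obtain N0 N1 N2 where split: "N = N0 # N1 # N2"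
    by (metis One_nat_def Suc_less_eq length_Cons list.exhaust list.size(3) not_less_zero)
  have "N1 = map (\<lambda>x. lit_bank (x, \<alpha> ! x)) [0..<num_vars \<phi>]"
    using nth_reduced_network[OF valid num_banks_gt[OF valid], of 1 \<alpha>] creditors_edges(1)[OF valid]
      split N by simp
  then have "map (left \<circ> enc_nat) N1 = map enc_bool \<alpha>"
    using len by (auto simp: enc_nat_lit_bank list_eq_iff_nth_eq)
  then show "?F (enc_pair (enc_instance max_2_sat) (enc_solution max_assets) p) =
      enc_solution max_2_sat ((\<lambda>(\<phi>, N). assignment_of N) p)"
    by (simp add: p max_assets_def max_2_sat_def split[symmetric] \<alpha>_def[symmetric] enc_list_eq[of enc_bool])
      (simp add: split)
qed

text \<open>Local optima are preserved because each flip is realized by a swap between networks with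
  the same objective values; an improving flip would yield an improving swap.\<close>

lemma PLS_reduction_max_assets:
  "PLS_reduction max_2_sat max_assets reduced_instance (\<lambda>_. assignment_of)"
  unfolding PLS_reduction_def
proof (intro conjI ballI polytime_reduced_instance polytime_assignment_of reduced_instance_valid)
  fix \<phi> q assume valid: "\<phi> \<in> instances max_2_sat"
  {
    assume "q \<in> feasible max_assets (reduced_instance \<phi>)"
    then show "assignment_of q \<in> feasible max_2_sat \<phi>"
      using consistent_eq(1)[OF valid] by (simp add: max_assets_def max_2_sat_def)
  }
  assume q: "q \<in> local_optima max_assets (reduced_instance \<phi>)"
  define \<alpha> where "\<alpha> = assignment_of q"
  have "consistent (reduced_instance \<phi>) q"
    using q by (simp add: local_optima_def max_assets_def)
  then have len: "length \<alpha> = num_vars \<phi>" and q_eq: "q = reduced_network \<phi> \<alpha>"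
    using consistent_eq[OF valid] by (simp_all add: \<alpha>_def)
  have "objective max_2_sat \<phi> \<beta> \<le> objective max_2_sat \<phi> \<alpha>"
    if \<beta>: "\<beta> \<in> neighborhood max_2_sat \<phi> \<alpha>" for \<beta>
  proof -
    obtain x where x: "x < num_vars \<phi>" "\<beta> = \<alpha>[x := \<not> \<alpha> ! x]"
      using \<beta> by (auto simp: max_2_sat_def)
    have "reduced_network \<phi> \<beta> \<in> neighborhood max_assets (reduced_instance \<phi>) q"
      using flip_swaps[OF valid len x(1)] by (simp add: q_eq x(2) max_assets_def)
    moreover have "reduced_network \<phi> \<beta> \<in> feasible max_assets (reduced_instance \<phi>)"
      using consistent_reduced_network[OF valid] by (simp add: max_assets_def)
    ultimately have "objective max_assets (reduced_instance \<phi>) (reduced_network \<phi> \<beta>)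
        \<le> objective max_assets (reduced_instance \<phi>) (reduced_network \<phi> \<alpha>)"
      using q by (auto simp: local_optima_def q_eq)
    then show ?thesis
      using len x(2) by (simp add: objective_reduced_network[OF valid])
  qed
  then show "assignment_of q \<in> local_optima max_2_sat \<phi>"
    using len by (auto simp: local_optima_def \<alpha>_def[symmetric]) (simp add: max_2_sat_def)
qed

text \<open>Tightness needs the converse inclusion of neighborhoods: each swap of a reduced network
  is a flip, so improving swaps become improving flips.\<close>

lemma transition_graph_reduced_instance:
  assumes valid: "\<phi> \<in> instances max_2_sat"
    and "(q, q') \<in> transition_graph max_assets (reduced_instance \<phi>)"
  shows "(assignment_of q, assignment_of q') \<in> transition_graph max_2_sat \<phi>"
proof -
  have cons: "consistent (reduced_instance \<phi>) q" "consistent (reduced_instance \<phi>) q'"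
    and swap: "q' \<in> swaps (reduced_instance \<phi>) q"
    and less: "objective max_assets (reduced_instance \<phi>) q < objective max_assets (reduced_instance \<phi>) q'"
    using assms(2) by (simp_all add: transition_graph_def max_assets_def)
  note q = consistent_eq[OF valid cons(1)] and q' = consistent_eq[OF valid cons(2)]
  obtain x where "x < num_vars \<phi>" "assignment_of q' = (assignment_of q)[x := \<not> assignment_of q ! x]"
    using swaps_flip[OF valid q(1)] swap q(2) by metis
  then have "assignment_of q' \<in> neighborhood max_2_sat \<phi> (assignment_of q)"
    by (auto simp: max_2_sat_def)
  moreover have "objective max_2_sat \<phi> (assignment_of q) < objective max_2_sat \<phi> (assignment_of q')"
    using less objective_reduced_network[OF valid q(1)] objective_reduced_network[OF valid q'(1)]
      q(2) q'(2) by metis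
  moreover have "assignment_of q \<in> feasible max_2_sat \<phi>" "assignment_of q' \<in> feasible max_2_sat \<phi>"
    using q(1) q'(1) by (simp_all add: max_2_sat_def)
  ultimately show ?thesis by (simp add: transition_graph_def)
qed

theorem theorem5: "\<exists>h g. tight_PLS_reduction max_2_sat max_assets h g"
proof (intro exI)
  let ?R = "\<lambda>\<phi>. feasible max_assets (reduced_instance \<phi>)"
  have r: "reduced_network \<phi> \<alpha> \<in> ?R \<phi> \<and> assignment_of (reduced_network \<phi> \<alpha>) = \<alpha>"
    if "\<phi> \<in> instances max_2_sat" "\<alpha> \<in> feasible max_2_sat \<phi>" for \<phi> \<alpha>
    using that consistent_reduced_network assignment_of_reduced_network
    by (auto simp: max_assets_def max_2_sat_def)
  have path: "assignment_of (hd qs) = assignment_of (last qs) \<or>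
      (assignment_of (hd qs), assignment_of (last qs)) \<in> transition_graph max_2_sat \<phi>"
    if valid: "\<phi> \<in> instances max_2_sat" and len: "2 \<le> length qs"
      and arcs: "\<And>i. Suc i < length qs \<Longrightarrow> (qs ! i, qs ! Suc i) \<in> transition_graph max_assets (reduced_instance \<phi>)"
      and inner: "\<And>i. 0 < i \<Longrightarrow> Suc i < length qs \<Longrightarrow> qs ! i \<notin> ?R \<phi>" for \<phi> qs
  proof -
    \<comment> \<open>Arcs join feasible solutions, all of which are reasonable, so a path whose
      inner vertices are not reasonable has no inner vertex and is a single arc.\<close>
    have "\<not> 2 < length qs"
    proof
      assume "2 < length qs"
      then have "qs ! 1 \<in> ?R \<phi>" using arcs[of 0] by (auto simp: transition_graph_def)
      with inner[of 1] \<open>2 < length qs\<close> show False by simp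
    qed
    with len have "length qs = 2" by simp
    moreover from this have "qs \<noteq> []" by auto
    ultimately have "hd qs = qs ! 0" "last qs = qs ! Suc 0"
      by (simp_all add: hd_conv_nth last_conv_nth)
    with transition_graph_reduced_instance[OF valid arcs[of 0]] \<open>length qs = 2\<close> show ?thesis by simp
  qed
  show "tight_PLS_reduction max_2_sat max_assets reduced_instance (\<lambda>_. assignment_of)"
    unfolding tight_PLS_reduction_def
  proof (intro conjI exI[of _ ?R] exI[of _ reduced_network] PLS_reduction_max_assets
      polytime_reduced_network ballI allI impI)
    show "local_optima max_assets (reduced_instance \<phi>) \<subseteq> ?R \<phi>" for \<phi>
      by (auto simp: local_optima_def)
  qed (use r path in auto)
qed

end
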